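(* Let $X_1,\ldots,X_n$ be independent random variables with values in a measurable space $(\mathscr X,\mathcal X)$ and let $\mathscr F$ be an at most countable class of functions on $\mathscr X$ with values in $[-1,1]$ which is VC-subgraph with dimension not larger than $V\ge1$. Let $$Z(\mathscr F)=\sup_{f\in\mathscr F}\Big|\sum_{i=1}^n\big(f(X_i)-\mathbb E[f(X_i)]\big)\Big|$$ and let $\sigma\in(0,1]$ satisfy $\sup_{f\in\mathscr F}\frac1n\sum_{i=1}^n\mathbb E[f^2(X_i)]\le\sigma^2$. Then $$\mathbb E[Z(\mathscr F)]\le 4.74\sqrt{nV\sigma^2\mathcal L(\sigma)}+90V\mathcal L(\sigma),\qquad\mathcal L(\sigma)=9.11+\log(1/\sigma^2).$$
   Context: A class of real functions on $\mathscr X$ is VC-subgraph with dimension not larger than $V$ if the family of subgraphs $\{(x,t)\in\mathscr X\times\mathbb R:\ f(x)>t\}$, $f$ in the class, shatters no finite subset of $\mathscr X\times\mathbb R$ of cardinality larger than $V$. *)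

theory Defs
  imports "HOL-Probability.Probability"
begin

definition shatters :: "'a set set \<Rightarrow> 'a set \<Rightarrow> bool" where
  "shatters C S \<longleftrightarrow> (\<forall>T\<subseteq>S. \<exists>A\<in>C. A \<inter> S = T)"

definition subgraph :: "'a set \<Rightarrow> ('a \<Rightarrow> real) \<Rightarrow> ('a \<times> real) set" where
  "subgraph X f = {(x, t). x \<in> X \<and> f x > t}"

definition VC_subgraph_le :: "'a set \<Rightarrow> ('a \<Rightarrow> real) set \<Rightarrow> real \<Rightarrow> bool" where
  "VC_subgraph_le X F V \<longleftrightarrow>
     (\<forall>S. S \<subseteq> X \<times> (UNIV :: real set) \<and> finite S \<and> real (card S) > V
          \<longrightarrow> \<not> shatters (subgraph X ` F) S)"

end

theory Submission
  imports Defs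
begin

text \<open>
  Symmetrization bounds \<open>E Z\<close> by twice the expected Rademacher average of the class at the sample.
  For a fixed sample \<open>x\<close> this average is controlled by chaining along nets of radii \<open>4\<^sup>-\<^sup>k sqrt S\<close>,
  where \<open>S\<close> is the largest empirical second moment: a packing of squared radius \<open>e\<close> has logarithmic
  size at most \<open>V (6 + 3/2 ln (1/e))\<close>, because greedily chosen points of the product with the real
  line separate all its subgraphs, to which the Sauer--Shelah lemma applies. The resulting bound is
  \<open>Y = 2.37 sqrt (n V g S)\<close> with the concave function \<open>g y = y (9.11 + ln (1/y))\<close>. Applied to the
  squares \<open>f\<^sup>2\<close>, the same chain gives \<open>E S \<le> \<sigma>\<^sup>2 + 4 E Y / n\<close>. Since \<open>(E Y)\<^sup>2 \<le> E Y\<^sup>2\<close> and \<open>g\<close> lies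
  below its tangent at \<open>\<sigma>\<^sup>2\<close>, this turns into a quadratic inequality for \<open>E Y\<close>.
\<close>

subsection \<open>The Sauer--Shelah lemma\<close>

lemma card_eq_card_image_remove_add_card:
  assumes "finite A"
  shows "card A = card ((\<lambda>a. a - {x}) ` A) + card {a \<in> A. x \<notin> a \<and> insert x a \<in> A}"
proof -
  let ?without = "{a \<in> A. x \<notin> a}" and ?with = "{a \<in> A. x \<in> a}"
  let ?removed = "(\<lambda>a. a - {x}) ` ?with"
  have split: "A = ?without \<union> ?with" by auto
  have "card A = card (?without \<union> ?with)" by (fact arg_cong[OF split, of card])
  also have "\<dots> = card ?without + card ?with"
    using assms by (intro card_Un_disjoint) auto
  also have "card ?with = card ?removed"
    by (subst card_image) (auto simp: inj_on_def)
  also have "card ?without + card ?removed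
      = card (?without \<union> ?removed) + card (?without \<inter> ?removed)"
    using assms by (intro card_Un_Int) auto
  also have "?without \<union> ?removed = (\<lambda>a. a - {x}) ` A"
  proof -
    have "(\<lambda>a. a - {x}) ` ?without = (\<lambda>a. a) ` ?without" by (intro image_cong) auto
    then have "?without \<union> ?removed = (\<lambda>a. a - {x}) ` (?without \<union> ?with)" by (simp add: image_Un)
    then show ?thesis by (simp flip: split)
  qed
  also have "?without \<inter> ?removed = {a \<in> A. x \<notin> a \<and> insert x a \<in> A}"
  proof -
    have "a \<in> ?removed" if "x \<notin> a" "insert x a \<in> A" for a
      using that by (intro image_eqI[of _ _ "insert x a"]) auto
    then show ?thesis by (auto simp: insert_absorb)
  qed
  finally show ?thesis .
qed

lemma shatters_imageD:
  assumes "shatters (g ` A) B" "\<And>a. a \<in> A \<Longrightarrow> g a \<inter> B = a \<inter> B"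
  shows "shatters A B"
  using assms by (simp add: shatters_def)

lemma shatters_insert:
  assumes "x \<notin> B" "shatters {a \<in> A. x \<notin> a \<and> insert x a \<in> A} B"
  shows "shatters A (insert x B)"
  unfolding shatters_def
proof (intro allI impI)
  fix T assume "T \<subseteq> insert x B"
  then have "T - {x} \<subseteq> B" by auto
  with assms(2) have "\<exists>a\<in>{a \<in> A. x \<notin> a \<and> insert x a \<in> A}. a \<inter> B = T - {x}"
    by (simp only: shatters_def)
  then obtain a where a: "a \<in> A" "x \<notin> a" "insert x a \<in> A" "a \<inter> B = T - {x}" by auto
  show "\<exists>a\<in>A. a \<inter> insert x B = T"
  proof (cases "x \<in> T")
    case True
    then have "insert x a \<inter> insert x B = T" using a(4) assms(1) by auto
    then show ?thesis using a(3) by blast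
  next
    case False
    then have "a \<inter> insert x B = T" using a(2,4) by auto
    then show ?thesis using a(1) by blast
  qed
qed

lemma card_le_card_shattered:
  assumes "finite S" "A \<subseteq> Pow S"
  shows "card A \<le> card {B. B \<subseteq> S \<and> shatters A B}"
  using assms
proof (induction S arbitrary: A rule: finite_induct)
  case empty
  then have "A = {} \<or> A = {{}}" by auto
  then show ?case
  proof
    assume "A = {{}}"
    then have "{B. B \<subseteq> {} \<and> shatters A B} = {{}}" by (auto simp: shatters_def)
    with \<open>A = {{}}\<close> show ?thesis by simp
  qed simp
next
  case (insert x S A)
  define C where "C = (\<lambda>a. a - {x}) ` A"
  define D where "D = {a \<in> A. x \<notin> a \<and> insert x a \<in> A}"
  let ?shattered = "\<lambda>A. {B. B \<subseteq> S \<and> shatters A B}"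
  have "finite A"
    using insert.prems insert.hyps(1) by (meson finite_Pow_iff finite_insert finite_subset)
  then have "card A = card C + card D"
    unfolding C_def D_def by (rule card_eq_card_image_remove_add_card)
  also have "\<dots> \<le> card (?shattered C) + card (?shattered D)"
    using insert.prems by (intro add_mono insert.IH) (auto simp: C_def D_def)
  also have "card (?shattered D) = card (insert x ` ?shattered D)"
    using insert.hyps(2) by (subst card_image) (auto simp: inj_on_def)
  also have "card (?shattered C) + \<dots> = card (?shattered C \<union> insert x ` ?shattered D)"
    using insert.hyps by (intro card_Un_disjoint[symmetric]) auto
  also have "\<dots> \<le> card {B. B \<subseteq> insert x S \<and> shatters A B}"
  proof (rule card_mono)
    show "finite {B. B \<subseteq> insert x S \<and> shatters A B}" using insert.hyps by simp
    have "shatters A B" if "B \<subseteq> S" "shatters C B" for B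
      using that insert.hyps(2) unfolding C_def by (elim shatters_imageD) auto
    moreover have "shatters A (insert x B)" if "B \<subseteq> S" "shatters D B" for B
      using that insert.hyps(2) unfolding D_def by (intro shatters_insert) auto
    ultimately show "?shattered C \<union> insert x ` ?shattered D \<subseteq> {B. B \<subseteq> insert x S \<and> shatters A B}"
      by auto
  qed
  finally show ?case .
qed

lemma sum_Pow_power_card:
  fixes z :: "'b::comm_semiring_1"
  assumes "finite P"
  shows "(\<Sum>B\<in>Pow P. z ^ card B) = (1 + z) ^ card P"
  using prod_add[OF assms, of "\<lambda>_. z" "\<lambda>_. 1"] by (simp add: add.commute)

lemma one_plus_power_le_exp:
  fixes x :: real
  assumes "- 1 \<le> x"
  shows "(1 + x) ^ m \<le> exp (x * real m)"
proof -
  have "(1 + x) ^ m \<le> exp x ^ m" using assms by (intro power_mono) auto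
  also have "\<dots> = exp (x * real m)" by (simp add: exp_of_nat_mult[symmetric] mult.commute)
  finally show ?thesis .
qed

text \<open>Weighting each shattered set \<open>B\<close> by \<open>z\<^bsup>card B\<^esup> \<ge> z\<^bsup>V\<^esup>\<close> replaces the usual sum of binomial
  coefficients by \<open>(1 + z)\<^bsup>card P\<^esup>\<close> and needs no integrality of \<open>V\<close>.\<close>

lemma ln_card_le_of_shattered_card_le:
  fixes V z :: real
  assumes P: "finite P" "A \<subseteq> Pow P" "A \<noteq> {}" and z: "0 < z" "z \<le> 1"
    and VC: "\<And>B. B \<subseteq> P \<Longrightarrow> shatters A B \<Longrightarrow> real (card B) \<le> V"
  shows "ln (real (card A)) \<le> V * ln (1 / z) + z * real (card P)"
proof -
  have "finite A" using P finite_subset by blast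
  then have pos: "card A > 0" using P by (simp add: card_gt_0_iff)
  let ?shattered = "{B. B \<subseteq> P \<and> shatters A B}"
  have "real (card A) * z powr V \<le> real (card ?shattered) * z powr V"
    using card_le_card_shattered[OF P(1,2)] by (intro mult_right_mono) auto
  also have "\<dots> = (\<Sum>B\<in>?shattered. z powr V)" by simp
  also have "\<dots> \<le> (\<Sum>B\<in>?shattered. z ^ card B)"
    using VC z by (intro sum_mono) (auto simp: powr_realpow[symmetric] intro!: powr_mono')
  also have "\<dots> \<le> (\<Sum>B\<in>Pow P. z ^ card B)"
    using P z by (intro sum_mono2) auto
  also have "\<dots> = (1 + z) ^ card P" using P by (intro sum_Pow_power_card)
  also have "\<dots> \<le> exp (z * real (card P))" using z by (intro one_plus_power_le_exp) simp
  finally have "ln (real (card A) * z powr V) \<le> z * real (card P)"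
    using pos z by (subst ln_exp[symmetric], subst ln_le_cancel_iff) auto
  then have "ln (real (card A)) + V * ln z \<le> z * real (card P)"
    using pos z by (simp add: ln_mult ln_powr)
  then show ?thesis using z by (simp add: ln_div)
qed

lemma VC_subgraph_le_subset: "VC_subgraph_le X F V \<Longrightarrow> T \<subseteq> F \<Longrightarrow> VC_subgraph_le X T V"
  unfolding VC_subgraph_le_def shatters_def by (meson image_mono subsetD)

lemma ln_card_le_of_inj_on_subgraph_traces:
  fixes V z :: real
  assumes P: "finite P" "P \<subseteq> X \<times> UNIV" and T: "T \<noteq> {}" and VC: "VC_subgraph_le X T V"
    and inj: "inj_on (\<lambda>f. subgraph X f \<inter> P) T" and z: "0 < z" "z \<le> 1"
  shows "ln (real (card T)) \<le> V * ln (1 / z) + z * real (card P)"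
proof -
  let ?traces = "(\<lambda>a. a \<inter> P) ` subgraph X ` T"
  have "card T = card ?traces" using card_image[OF inj] by (simp add: image_image)
  moreover have "ln (real (card ?traces)) \<le> V * ln (1 / z) + z * real (card P)"
  proof (rule ln_card_le_of_shattered_card_le[OF P(1) _ _ z])
    fix B assume B: "B \<subseteq> P" "shatters ?traces B"
    from B(2) have "shatters (subgraph X ` T) B" by (rule shatters_imageD) (use B(1) in auto)
    moreover have "finite B" "B \<subseteq> X \<times> UNIV" using B(1) P finite_subset by auto
    ultimately show "real (card B) \<le> V" using VC unfolding VC_subgraph_le_def by (meson not_le)
  qed (use T in auto)
  ultimately show ?thesis by simp
qed

subsection \<open>Packing numbers of VC-subgraph classes\<close>

definition mean_square :: "'i set \<Rightarrow> ('i \<Rightarrow> real) \<Rightarrow> real" where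
  "mean_square I v = (\<Sum>i\<in>I. (v i)\<^sup>2) / real (card I)"

lemma card_times_mean_square: "real (card I) * mean_square I v = (\<Sum>i\<in>I. (v i)\<^sup>2)"
  by (cases "finite I") (auto simp: mean_square_def)

lemma mean_square_nonneg: "0 \<le> mean_square I v"
  by (simp add: mean_square_def sum_nonneg)

lemma mean_square_le_1:
  assumes "\<And>i. i \<in> I \<Longrightarrow> \<bar>v i\<bar> \<le> 1"
  shows "mean_square I v \<le> 1"
proof -
  have "(\<Sum>i\<in>I. (v i)\<^sup>2) \<le> (\<Sum>i\<in>I. 1)" using assms by (intro sum_mono) (simp add: abs_square_le_1)
  then show ?thesis by (cases "card I = 0") (simp_all add: mean_square_def)
qed

lemma exists_hitting_set_greedy:
  fixes hits :: "'p \<Rightarrow> 'u \<Rightarrow> bool" and p :: real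
  assumes U: "finite U" and p: "p \<le> 1"
    and avg: "\<And>W. W \<subseteq> U \<Longrightarrow> W \<noteq> {} \<Longrightarrow> \<exists>\<omega>\<in>\<Omega>. p * real (card W) \<le> real (card {u\<in>W. hits \<omega> u})"
  shows "\<exists>P\<subseteq>\<Omega>. finite P \<and> card P \<le> m \<and>
    real (card {u\<in>U. \<forall>\<omega>\<in>P. \<not> hits \<omega> u}) \<le> (1 - p) ^ m * real (card U)"
proof (induction m)
  case 0
  show ?case by (intro exI[of _ "{}"]) auto
next
  case (Suc m)
  then obtain P where P: "P \<subseteq> \<Omega>" "finite P" "card P \<le> m"
    "real (card {u\<in>U. \<forall>\<omega>\<in>P. \<not> hits \<omega> u}) \<le> (1 - p) ^ m * real (card U)" by blast
  define W where "W = {u\<in>U. \<forall>\<omega>\<in>P. \<not> hits \<omega> u}"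
  show ?case
  proof (cases "W = {}")
    case True
    then have "real (card W) \<le> (1 - p) ^ Suc m * real (card U)" using p by simp
    then show ?thesis using P by (intro exI[of _ P]) (auto simp: W_def)
  next
    case False
    have W: "W \<subseteq> U" "finite W" using U by (auto simp: W_def)
    from avg[OF W(1) False] obtain \<omega>
      where \<omega>: "\<omega> \<in> \<Omega>" "p * real (card W) \<le> real (card {u\<in>W. hits \<omega> u})" by auto
    have "{u\<in>U. \<forall>\<omega>'\<in>insert \<omega> P. \<not> hits \<omega>' u} = W - {u\<in>W. hits \<omega> u}" by (auto simp: W_def)
    then have "real (card {u\<in>U. \<forall>\<omega>'\<in>insert \<omega> P. \<not> hits \<omega>' u})
        = real (card W) - real (card {u\<in>W. hits \<omega> u})"
      using W(2) by (simp add: card_Diff_subset card_mono of_nat_diff)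
    also have "\<dots> \<le> (1 - p) * real (card W)" using \<omega>(2) by (simp add: algebra_simps)
    also have "\<dots> \<le> (1 - p) * ((1 - p) ^ m * real (card U))"
      using P(4) p by (intro mult_left_mono) (auto simp: W_def)
    finally show ?thesis using P(1-3) \<omega>(1)
      by (intro exI[of _ "insert \<omega> P"]) (auto simp: card_insert_if algebra_simps)
  qed
qed

lemma exists_hitting_set:
  fixes hits :: "'p \<Rightarrow> 'u \<Rightarrow> bool" and p :: real
  assumes U: "finite U" and p: "p \<le> 1"
    and avg: "\<And>W. W \<subseteq> U \<Longrightarrow> W \<noteq> {} \<Longrightarrow> \<exists>\<omega>\<in>\<Omega>. p * real (card W) \<le> real (card {u\<in>W. hits \<omega> u})"
    and m: "real (card U) < exp (p * real m)"
  shows "\<exists>P\<subseteq>\<Omega>. finite P \<and> card P \<le> m \<and> (\<forall>u\<in>U. \<exists>\<omega>\<in>P. hits \<omega> u)"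
proof -
  obtain P where P: "P \<subseteq> \<Omega>" "finite P" "card P \<le> m"
    "real (card {u\<in>U. \<forall>\<omega>\<in>P. \<not> hits \<omega> u}) \<le> (1 - p) ^ m * real (card U)"
    using exists_hitting_set_greedy[OF U p avg] by blast
  note P(4)
  also have "(1 - p) ^ m * real (card U) \<le> exp (- p * real m) * real (card U)"
    using one_plus_power_le_exp[of "- p" m] p by (intro mult_right_mono) auto
  also have "\<dots> < exp (- p * real m) * exp (p * real m)" using m by simp
  also have "\<dots> = 1" by (simp add: exp_add[symmetric])
  finally have "card {u\<in>U. \<forall>\<omega>\<in>P. \<not> hits \<omega> u} = 0" by linarith
  then have "\<forall>u\<in>U. \<exists>\<omega>\<in>P. hits \<omega> u" using U by auto
  then show ?thesis using P(1-3) by blast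
qed

text \<open>A level uniform in \<open>[l,r]\<close> separates \<open>a u\<close> from \<open>b u\<close> with probability \<open>\<bar>a u - b u\<bar> / (r - l)\<close>.\<close>

lemma exists_separating_level:
  fixes a b :: "'u \<Rightarrow> real" and l r :: real
  assumes U: "finite U" and "l \<le> r" and ab: "\<And>u. u \<in> U \<Longrightarrow> a u \<in> {l..r} \<and> b u \<in> {l..r}"
  shows "\<exists>t. (\<Sum>u\<in>U. \<bar>a u - b u\<bar>) \<le> (r - l) * real (card {u\<in>U. (t < a u) \<noteq> (t < b u)})"
proof -
  define cnt where "cnt t = card {u\<in>U. (t < a u) \<noteq> (t < b u)}" for t
  have "cnt t < Suc (card U)" for t
    using U by (simp add: cnt_def less_Suc_eq_le card_mono)
  then obtain t where t: "\<And>t'. cnt t' \<le> cnt t"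
    using ex_has_greatest_nat[of "\<lambda>_. True" _ cnt "Suc (card U)"] by auto
  define between where "between u = {min (a u) (b u) ..< max (a u) (b u)}" for u
  have "(\<Sum>u\<in>U. \<bar>a u - b u\<bar>) = (\<integral>t. (\<Sum>u\<in>U. indicator (between u) t) \<partial>lborel)"
    by (auto simp: between_def intro!: sum.cong)
  also have "\<dots> \<le> (\<integral>t'. real (cnt t) * indicator {l..r} t' \<partial>lborel)"
  proof (rule Bochner_Integration.integral_mono)
    show "integrable lborel (\<lambda>t. \<Sum>u\<in>U. indicator (between u) t :: real)"
      by (intro Bochner_Integration.integrable_sum) (auto simp: between_def)
    show "integrable lborel (\<lambda>t'. real (cnt t) * indicator {l..r} t')"
      using \<open>l \<le> r\<close> by (intro integrable_mult_right integrable_real_indicator) auto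
    fix t'
    show "(\<Sum>u\<in>U. indicator (between u) t') \<le> real (cnt t) * indicator {l..r} t'"
    proof (cases "t' \<in> {l..r}")
      case True
      have "(\<Sum>u\<in>U. indicator (between u) t')
          = (\<Sum>u\<in>U. if (t' < a u) \<noteq> (t' < b u) then 1 else 0 :: real)"
        by (intro sum.cong refl) (auto simp: between_def indicator_def)
      also have "\<dots> = real (cnt t')" using U by (simp add: sum.If_cases Int_def cnt_def)
      also have "\<dots> \<le> real (cnt t) * indicator {l..r} t'" using t True by simp
      finally show ?thesis .
    next
      case False
      then have "(\<Sum>u\<in>U. indicator (between u) t') = (\<Sum>u\<in>U. 0 :: real)"
        using ab by (intro sum.cong refl) (force simp: between_def indicator_def)
      then show ?thesis using False by simp
    qed
  qed
  also have "\<dots> = (r - l) * real (cnt t)" using \<open>l \<le> r\<close> by simp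
  finally show ?thesis unfolding cnt_def by blast
qed

lemma mean_square_diff_le_sum_abs_diff:
  assumes "\<And>i. i \<in> I \<Longrightarrow> \<bar>u i\<bar> \<le> 1" "\<And>i. i \<in> I \<Longrightarrow> \<bar>v i\<bar> \<le> 1"
  shows "real (card I) * mean_square I (\<lambda>i. u i - v i) \<le> 2 * (\<Sum>i\<in>I. \<bar>u i - v i\<bar>)"
  unfolding card_times_mean_square sum_distrib_left
proof (rule sum_mono)
  fix i assume "i \<in> I"
  then have "\<bar>u i - v i\<bar> \<le> 2" using assms[of i] by linarith
  then have "\<bar>u i - v i\<bar> * \<bar>u i - v i\<bar> \<le> 2 * \<bar>u i - v i\<bar>" by (rule mult_right_mono) simp
  then show "(u i - v i)\<^sup>2 \<le> 2 * \<bar>u i - v i\<bar>" by (simp add: power2_eq_square)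
qed

lemma exists_separating_point:
  fixes x :: "'i \<Rightarrow> 'a" and e :: real
  assumes I: "finite I" "I \<noteq> {}" and W: "finite W"
    and bnd: "\<And>f g i. (f, g) \<in> W \<Longrightarrow> i \<in> I \<Longrightarrow> \<bar>f (x i)\<bar> \<le> 1 \<and> \<bar>g (x i)\<bar> \<le> 1"
    and sep: "\<And>f g. (f, g) \<in> W \<Longrightarrow> e \<le> mean_square I (\<lambda>i. f (x i) - g (x i))"
  shows "\<exists>i\<in>I. \<exists>t. e / 4 * real (card W) \<le> real (card {(f, g)\<in>W. (t < f (x i)) \<noteq> (t < g (x i))})"
proof -
  have "\<exists>i\<in>I. e / 2 * real (card W) \<le> (\<Sum>(f, g)\<in>W. \<bar>f (x i) - g (x i)\<bar>)"
  proof (rule ccontr)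
    assume "\<not> ?thesis"
    then have "(\<Sum>i\<in>I. \<Sum>(f, g)\<in>W. \<bar>f (x i) - g (x i)\<bar>) < (\<Sum>i\<in>I. e / 2 * real (card W))"
      using I by (intro sum_strict_mono) auto
    also have "\<dots> = (\<Sum>(f, g)\<in>W. real (card I) * e / 2)" by simp
    also have "\<dots> \<le> (\<Sum>(f, g)\<in>W. \<Sum>i\<in>I. \<bar>f (x i) - g (x i)\<bar>)"
    proof (intro sum_mono, clarify)
      fix f g assume fg: "(f, g) \<in> W"
      have "real (card I) * e \<le> real (card I) * mean_square I (\<lambda>i. f (x i) - g (x i))"
        using sep[OF fg] by (intro mult_left_mono) auto
      also have "\<dots> \<le> 2 * (\<Sum>i\<in>I. \<bar>f (x i) - g (x i)\<bar>)"
        using bnd[OF fg] by (intro mean_square_diff_le_sum_abs_diff) auto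
      finally show "real (card I) * e / 2 \<le> (\<Sum>i\<in>I. \<bar>f (x i) - g (x i)\<bar>)" by simp
    qed
    also have "\<dots> = (\<Sum>i\<in>I. \<Sum>(f, g)\<in>W. \<bar>f (x i) - g (x i)\<bar>)"
      unfolding case_prod_unfold by (rule sum.swap)
    finally show False by simp
  qed
  then obtain i where i: "i \<in> I" "e / 2 * real (card W) \<le> (\<Sum>u\<in>W. \<bar>fst u (x i) - snd u (x i)\<bar>)"
    by (auto simp: case_prod_unfold)
  have "\<exists>t. (\<Sum>u\<in>W. \<bar>fst u (x i) - snd u (x i)\<bar>)
      \<le> (1 - (- 1)) * real (card {u\<in>W. (t < fst u (x i)) \<noteq> (t < snd u (x i))})"
    using W bnd[OF _ i(1)] by (intro exists_separating_level) (auto simp: abs_le_iff)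
  then obtain t where "(\<Sum>u\<in>W. \<bar>fst u (x i) - snd u (x i)\<bar>)
      \<le> 2 * real (card {u\<in>W. (t < fst u (x i)) \<noteq> (t < snd u (x i))})" by auto
  then have "e / 4 * real (card W) \<le> real (card {(f, g)\<in>W. (t < f (x i)) \<noteq> (t < g (x i))})"
    using i(2) by (simp add: case_prod_unfold)
  then show ?thesis using i(1) by blast
qed

lemma card_distinct_pairs_less:
  assumes "finite T" "T \<noteq> {}"
  shows "card {(f, g). f \<in> T \<and> g \<in> T \<and> f \<noteq> g} < (card T)\<^sup>2"
proof -
  obtain f where "f \<in> T" using assms(2) by blast
  then have "(f, f) \<in> T \<times> T - {(f, g). f \<in> T \<and> g \<in> T \<and> f \<noteq> g}" by simp
  then have "{(f, g). f \<in> T \<and> g \<in> T \<and> f \<noteq> g} \<subset> T \<times> T" by auto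
  then have "card {(f, g). f \<in> T \<and> g \<in> T \<and> f \<noteq> g} < card (T \<times> T)"
    using assms(1) by (intro psubset_card_mono) auto
  then show ?thesis by (simp add: card_cartesian_product power2_eq_square)
qed

text \<open>There are fewer than \<open>N\<^sup>2 \<le> exp (m e / 4)\<close> pairs among \<open>N\<close> functions once \<open>m \<ge> 8 ln N / e\<close>.\<close>

lemma exists_subgraph_separating_set:
  fixes x :: "'i \<Rightarrow> 'a" and e :: real
  assumes I: "finite I" "I \<noteq> {}" and x: "\<And>i. i \<in> I \<Longrightarrow> x i \<in> X"
    and T: "finite T" "T \<noteq> {}" and e: "0 < e" "e \<le> 1"
    and bnd: "\<And>f i. f \<in> T \<Longrightarrow> i \<in> I \<Longrightarrow> \<bar>f (x i)\<bar> \<le> 1"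
    and sep: "pairwise (\<lambda>f g. e < mean_square I (\<lambda>i. f (x i) - g (x i))) T"
  shows "\<exists>P\<subseteq>X \<times> UNIV. finite P \<and> real (card P) \<le> 8 * ln (real (card T)) / e + 1
    \<and> inj_on (\<lambda>f. subgraph X f \<inter> P) T"
proof -
  define N where "N = real (card T)"
  have N: "1 \<le> N" using T by (simp add: N_def Suc_le_eq card_gt_0_iff)
  define m where "m = nat \<lceil>8 * ln N / e\<rceil>"
  have "0 \<le> 8 * ln N / e" using N e by simp
  then have m: "8 * ln N / e \<le> real m" "real m \<le> 8 * ln N / e + 1"
    unfolding m_def by linarith+
  define U where "U = {(f, g). f \<in> T \<and> g \<in> T \<and> f \<noteq> g}"
  have U: "finite U" using finite_subset[of U "T \<times> T"] T(1) by (auto simp: U_def)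
  have "real (card U) < N\<^sup>2"
    using card_distinct_pairs_less[OF T] by (simp add: U_def N_def flip: of_nat_power)
  also have "N\<^sup>2 = exp (2 * ln N)" using N by (simp add: exp_double)
  also have "\<dots> \<le> exp (e / 4 * real m)" using m(1) e by (simp add: field_simps)
  finally have card_U: "real (card U) < exp (e / 4 * real m)" .
  let ?separates = "\<lambda>p (f, g). (snd p < f (fst p)) \<noteq> (snd p < g (fst p))"
  have "\<exists>P\<subseteq>X \<times> UNIV. finite P \<and> card P \<le> m \<and> (\<forall>u\<in>U. \<exists>p\<in>P. ?separates p u)"
  proof (rule exists_hitting_set[OF U _ _ card_U])
    fix W assume W: "W \<subseteq> U"
    have "\<exists>i\<in>I. \<exists>t. e / 4 * real (card W) \<le> real (card {(f, g)\<in>W. (t < f (x i)) \<noteq> (t < g (x i))})"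
    proof (rule exists_separating_point[OF I finite_subset[OF W U]])
      show "e \<le> mean_square I (\<lambda>i. f (x i) - g (x i))" if "(f, g) \<in> W" for f g
        using that W sep by (auto simp: U_def pairwise_def intro: less_imp_le)
    qed (use W bnd in \<open>auto simp: U_def\<close>)
    then show "\<exists>p\<in>X \<times> UNIV. e / 4 * real (card W) \<le> real (card {u\<in>W. ?separates p u})"
      using x by (fastforce simp: case_prod_unfold)
  qed (use e in simp)
  then obtain P where P: "P \<subseteq> X \<times> UNIV" "finite P" "card P \<le> m" "\<And>u. u \<in> U \<Longrightarrow> \<exists>p\<in>P. ?separates p u"
    by blast
  have "inj_on (\<lambda>f. subgraph X f \<inter> P) T"
  proof (rule inj_onI, rule ccontr)
    fix f g assume fg: "f \<in> T" "g \<in> T" "subgraph X f \<inter> P = subgraph X g \<inter> P" "f \<noteq> g"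
    then obtain p where "p \<in> P" "?separates p (f, g)" using P(4)[of "(f, g)"] by (auto simp: U_def)
    then have "p \<in> P" "(p \<in> subgraph X f) \<noteq> (p \<in> subgraph X g)"
      using P(1) by (auto simp: subgraph_def)
    then show False using fg(3) by blast
  qed
  moreover have "real (card P) \<le> 8 * ln N / e + 1" using P(3) m(2) by linarith
  ultimately show ?thesis using P(1,2) unfolding N_def by blast
qed

lemma ln_packing_le:
  fixes x :: "'i \<Rightarrow> 'a" and e V :: real
  assumes I: "finite I" "I \<noteq> {}" and x: "\<And>i. i \<in> I \<Longrightarrow> x i \<in> X"
    and T: "finite T" "T \<noteq> {}" and e: "0 < e" "e \<le> 1"
    and bnd: "\<And>f i. f \<in> T \<Longrightarrow> i \<in> I \<Longrightarrow> \<bar>f (x i)\<bar> \<le> 1"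
    and sep: "pairwise (\<lambda>f g. e < mean_square I (\<lambda>i. f (x i) - g (x i))) T"
    and VC: "VC_subgraph_le X T V" and V: "1 \<le> V"
  shows "ln (real (card T)) \<le> V * (6 + 3 / 2 * ln (1 / e))"
proof -
  define N where "N = real (card T)"
  obtain P where P: "P \<subseteq> X \<times> UNIV" "finite P" "real (card P) \<le> 8 * ln N / e + 1"
    "inj_on (\<lambda>f. subgraph X f \<inter> P) T"
    using exists_subgraph_separating_set[OF I _ T e _ sep, of X] x bnd unfolding N_def by blast
  have "ln N \<le> V * ln (1 / (e / 24)) + e / 24 * real (card P)"
    unfolding N_def using P T VC e by (intro ln_card_le_of_inj_on_subgraph_traces) auto
  also have "e / 24 * real (card P) \<le> e / 24 * (8 * ln N / e + 1)"
    using P(3) e by (intro mult_left_mono) auto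
  also have "\<dots> = ln N / 3 + e / 24" using e by (simp add: field_simps)
  finally have self_bound: "ln N \<le> V * ln (1 / (e / 24)) + (ln N / 3 + e / 24)" by simp
  have "ln (24::real) \<le> ln (2 ^ 5)" by (subst ln_le_cancel_iff) auto
  also have "\<dots> = 5 * ln 2" by (subst ln_realpow) auto
  also have "\<dots> \<le> 7 / 2" using ln2_le_25_over_36 by simp
  finally have "ln (24::real) \<le> 7 / 2" .
  moreover have "ln (1 / (e / 24)) = ln 24 + ln (1 / e)" using e by (simp add: ln_div)
  ultimately have "V * ln (1 / (e / 24)) \<le> V * (7 / 2 + ln (1 / e))"
    using V by (intro mult_left_mono) auto
  moreover have "e / 24 \<le> V / 24" using e V by simp
  moreover have "V * (6 + 3 / 2 * ln (1 / e)) = 3 / 2 * (V * (7 / 2 + ln (1 / e))) + 3 / 4 * V"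
    by (simp add: algebra_simps)
  ultimately show ?thesis using self_bound V unfolding N_def by linarith
qed

subsection \<open>The largest absolute value of a finite family\<close>

definition max_abs :: "'j set \<Rightarrow> ('j \<Rightarrow> real) \<Rightarrow> real" where
  "max_abs J v = Max ((\<lambda>j. \<bar>v j\<bar>) ` J)"

lemma abs_le_max_abs: "finite J \<Longrightarrow> j \<in> J \<Longrightarrow> \<bar>v j\<bar> \<le> max_abs J v"
  unfolding max_abs_def by (intro Max_ge) auto

lemma max_abs_le:
  "finite J \<Longrightarrow> J \<noteq> {} \<Longrightarrow> (\<And>j. j \<in> J \<Longrightarrow> \<bar>v j\<bar> \<le> b) \<Longrightarrow> max_abs J v \<le> b"
  unfolding max_abs_def by (intro Max.boundedI) auto

lemma max_abs_attained:
  assumes "finite J" "J \<noteq> {}"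
  obtains j where "j \<in> J" "max_abs J v = \<bar>v j\<bar>"
proof -
  have "max_abs J v \<in> (\<lambda>j. \<bar>v j\<bar>) ` J" unfolding max_abs_def using assms by (intro Max_in) auto
  then show ?thesis using that by blast
qed

lemma max_abs_nonneg: "finite J \<Longrightarrow> J \<noteq> {} \<Longrightarrow> 0 \<le> max_abs J v"
  by (metis abs_ge_zero max_abs_attained)

lemma max_abs_add_le:
  assumes "finite J" "J \<noteq> {}"
  shows "max_abs J (\<lambda>j. u j + v j) \<le> max_abs J u + max_abs J v"
  using assms abs_le_max_abs[of J _ u] abs_le_max_abs[of J _ v]
  by (intro max_abs_le) (auto intro: order_trans[OF abs_triangle_ineq] add_mono)

lemma max_abs_cmult:
  assumes "finite J" "J \<noteq> {}"
  shows "max_abs J (\<lambda>j. c * v j) = \<bar>c\<bar> * max_abs J v"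
proof (rule antisym)
  show "max_abs J (\<lambda>j. c * v j) \<le> \<bar>c\<bar> * max_abs J v"
    using assms by (intro max_abs_le) (auto simp: abs_mult intro: mult_left_mono abs_le_max_abs)
  obtain j where "j \<in> J" "max_abs J v = \<bar>v j\<bar>" using assms by (rule max_abs_attained)
  then show "\<bar>c\<bar> * max_abs J v \<le> max_abs J (\<lambda>j. c * v j)"
    using abs_le_max_abs[OF assms(1), of j "\<lambda>j. c * v j"] by (simp add: abs_mult)
qed

lemma borel_measurable_max_abs [measurable (raw)]:
  assumes "finite J" "\<And>j. j \<in> J \<Longrightarrow> (\<lambda>\<omega>. v \<omega> j) \<in> borel_measurable M"
  shows "(\<lambda>\<omega>. max_abs J (v \<omega>)) \<in> borel_measurable M"
  unfolding max_abs_def using assms by (intro borel_measurable_Max borel_measurable_abs) auto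

lemma integrable_max_abs:
  fixes v :: "'a \<Rightarrow> 'j \<Rightarrow> real"
  assumes J: "finite J" "J \<noteq> {}" and v: "\<And>j. j \<in> J \<Longrightarrow> integrable M (\<lambda>\<omega>. v \<omega> j)"
  shows "integrable M (\<lambda>\<omega>. max_abs J (v \<omega>))"
proof (rule Bochner_Integration.integrable_bound)
  show "integrable M (\<lambda>\<omega>. \<Sum>j\<in>J. \<bar>v \<omega> j\<bar>)" using v by auto
  show "(\<lambda>\<omega>. max_abs J (v \<omega>)) \<in> borel_measurable M"
    using v by (intro borel_measurable_max_abs J) auto
  have "\<bar>v \<omega> j\<bar> \<le> (\<Sum>j\<in>J. \<bar>v \<omega> j\<bar>)" if "j \<in> J" for \<omega> j
    using J(1) that by (intro member_le_sum) auto
  then have "max_abs J (v \<omega>) \<le> (\<Sum>j\<in>J. \<bar>v \<omega> j\<bar>)" for \<omega>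
    using J by (intro max_abs_le) auto
  then show "AE \<omega> in M. norm (max_abs J (v \<omega>)) \<le> norm (\<Sum>j\<in>J. \<bar>v \<omega> j\<bar>)"
    using max_abs_nonneg[OF J] by (intro AE_I2) (simp add: sum_nonneg)
qed

lemma max_abs_integral_le:
  fixes v :: "'a \<Rightarrow> 'j \<Rightarrow> real"
  assumes J: "finite J" "J \<noteq> {}" and v: "\<And>j. j \<in> J \<Longrightarrow> integrable M (\<lambda>\<omega>. v \<omega> j)"
  shows "max_abs J (\<lambda>j. \<integral>\<omega>. v \<omega> j \<partial>M) \<le> (\<integral>\<omega>. max_abs J (v \<omega>) \<partial>M)"
proof (rule max_abs_le[OF J])
  fix j assume j: "j \<in> J"
  have "\<bar>\<integral>\<omega>. v \<omega> j \<partial>M\<bar> \<le> (\<integral>\<omega>. \<bar>v \<omega> j\<bar> \<partial>M)" by (rule integral_abs_bound)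
  also have "\<dots> \<le> (\<integral>\<omega>. max_abs J (v \<omega>) \<partial>M)"
    using v[OF j] J v j
    by (intro integral_mono integrable_max_abs integrable_abs abs_le_max_abs) auto
  finally show "\<bar>\<integral>\<omega>. v \<omega> j \<partial>M\<bar> \<le> (\<integral>\<omega>. max_abs J (v \<omega>) \<partial>M)" .
qed

subsection \<open>Sub-Gaussian processes and chaining\<close>

definition (in prob_space) subgaussian :: "real \<Rightarrow> ('a \<Rightarrow> real) \<Rightarrow> bool" where
  "subgaussian s Z \<longleftrightarrow> (\<forall>l. integrable M (\<lambda>\<omega>. exp (l * Z \<omega>)) \<and>
    expectation (\<lambda>\<omega>. exp (l * Z \<omega>)) \<le> exp ((l * s)\<^sup>2 / 2))"

context prob_space
begin

lemma subgaussian_mono: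
  assumes "subgaussian s Z" "0 \<le> s" "s \<le> t"
  shows "subgaussian t Z"
proof -
  have "exp ((l * s)\<^sup>2 / 2) \<le> exp ((l * t)\<^sup>2 / 2)" for l
    using assms(2,3) by (auto simp: power_mult_distrib intro!: mult_left_mono power_mono)
  then show ?thesis using assms(1) unfolding subgaussian_def by (meson order_trans)
qed

lemma integrable_subgaussian:
  assumes "subgaussian s Z"
  shows "integrable M Z"
proof (rule Bochner_Integration.integrable_bound)
  have exp_int: "integrable M (\<lambda>\<omega>. exp (l * Z \<omega>))" for l using assms by (simp add: subgaussian_def)
  show "integrable M (\<lambda>\<omega>. exp (Z \<omega>) + exp (- Z \<omega>))" using exp_int[of 1] exp_int[of "- 1"] by simp
  have "(\<lambda>\<omega>. ln (exp (Z \<omega>))) \<in> borel_measurable M"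
    using exp_int[of 1] by (intro borel_measurable_ln) auto
  then show "Z \<in> borel_measurable M" by simp
  have "\<bar>z\<bar> \<le> exp z + exp (- z)" for z :: real
    using exp_ge_add_one_self[of z] exp_ge_add_one_self[of "- z"]
      exp_gt_zero[of z] exp_gt_zero[of "- z"]
    by linarith
  then show "AE \<omega> in M. norm (Z \<omega>) \<le> norm (exp (Z \<omega>) + exp (- Z \<omega>))"
    by (simp add: abs_of_pos add_pos_pos)
qed

lemma exp_expectation_max_abs_le:
  fixes Z :: "'j \<Rightarrow> 'a \<Rightarrow> real"
  assumes T: "finite T" "T \<noteq> {}" and sub: "\<And>t. t \<in> T \<Longrightarrow> subgaussian s (Z t)" and l: "0 \<le> l"
  shows "exp (l * expectation (\<lambda>\<omega>. max_abs T (\<lambda>t. Z t \<omega>))) \<le> 2 * real (card T) * exp ((l * s)\<^sup>2 / 2)"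
proof -
  define m where "m = (\<lambda>\<omega>. max_abs T (\<lambda>t. Z t \<omega>))"
  have Z_int: "integrable M (Z t)" if "t \<in> T" for t using integrable_subgaussian[OF sub[OF that]] .
  then have m_int: "integrable M m" unfolding m_def by (intro integrable_max_abs T)
  have exp_int: "integrable M (\<lambda>\<omega>. exp (c * Z t \<omega>))"
    and exp_le: "expectation (\<lambda>\<omega>. exp (c * Z t \<omega>)) \<le> exp ((c * s)\<^sup>2 / 2)" if "t \<in> T" for c t
    using sub[OF that] by (auto simp: subgaussian_def)
  let ?sum = "\<lambda>\<omega>. \<Sum>t\<in>T. exp (l * Z t \<omega>) + exp (- l * Z t \<omega>)"
  have sum_int: "integrable M ?sum"
    by (intro Bochner_Integration.integrable_sum Bochner_Integration.integrable_add exp_int)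
  have exp_m_le: "exp (l * m \<omega>) \<le> ?sum \<omega>" for \<omega>
  proof -
    obtain t where t: "t \<in> T" "m \<omega> = \<bar>Z t \<omega>\<bar>" unfolding m_def using T by (rule max_abs_attained)
    have "exp (l * m \<omega>) \<le> exp (l * Z t \<omega>) + exp (- l * Z t \<omega>)" by (simp add: t(2) abs_if)
    also have "\<dots> \<le> ?sum \<omega>" using t(1) T(1) by (intro member_le_sum) (auto intro: add_nonneg_nonneg)
    finally show ?thesis .
  qed
  have exp_m_int: "integrable M (\<lambda>\<omega>. exp (l * m \<omega>))"
  proof (rule Bochner_Integration.integrable_bound[OF sum_int])
    show "(\<lambda>\<omega>. exp (l * m \<omega>)) \<in> borel_measurable M" using m_int by measurable
    show "AE \<omega> in M. norm (exp (l * m \<omega>)) \<le> norm (?sum \<omega>)"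
      using exp_m_le by (intro AE_I2) (metis abs_exp_cancel abs_ge_self order_trans real_norm_def)
  qed
  have "exp (l * expectation m) \<le> expectation (\<lambda>\<omega>. exp (l * m \<omega>))"
    using jensens_inequality[OF m_int _ _ exp_m_int convex_on_exp[OF l]] by simp
  also have "\<dots> \<le> expectation ?sum" by (rule integral_mono[OF exp_m_int sum_int exp_m_le])
  also have "\<dots> = (\<Sum>t\<in>T. expectation (\<lambda>\<omega>. exp (l * Z t \<omega>)) + expectation (\<lambda>\<omega>. exp (- l * Z t \<omega>)))"
    using exp_int[of _ l] exp_int[of _ "- l"] by (simp add: Bochner_Integration.integral_sum)
  also have "\<dots> \<le> (\<Sum>t\<in>T. exp ((l * s)\<^sup>2 / 2) + exp ((l * s)\<^sup>2 / 2))"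
    using exp_le[of _ l] exp_le[of _ "- l"] by (intro sum_mono add_mono) auto
  also have "\<dots> = 2 * real (card T) * exp ((l * s)\<^sup>2 / 2)" by simp
  finally show ?thesis unfolding m_def .
qed

lemma expectation_max_abs_subgaussian_le:
  fixes Z :: "'j \<Rightarrow> 'a \<Rightarrow> real"
  assumes T: "finite T" "T \<noteq> {}" and sub: "\<And>t. t \<in> T \<Longrightarrow> subgaussian s (Z t)" and s: "0 < s"
  shows "expectation (\<lambda>\<omega>. max_abs T (\<lambda>t. Z t \<omega>)) \<le> s * sqrt (2 * ln (2 * real (card T)))"
proof -
  define m where "m = expectation (\<lambda>\<omega>. max_abs T (\<lambda>t. Z t \<omega>))"
  define h where "h = ln (2 * real (card T))"
  have card_T: "1 \<le> card T" using T by (simp add: Suc_le_eq card_gt_0_iff)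
  then have h: "h > 0" by (simp add: h_def)
  define l where "l = sqrt (2 * h) / s"
  have l: "l > 0" using h s by (simp add: l_def)
  have "l * m \<le> ln (2 * real (card T) * exp ((l * s)\<^sup>2 / 2))"
    using exp_expectation_max_abs_le[OF T sub, where l = l] l card_T unfolding m_def
    by (subst ln_ge_iff) auto
  also have "\<dots> = h + (l * s)\<^sup>2 / 2" using card_T by (simp add: ln_mult h_def)
  also have "\<dots> = l * (s * sqrt (2 * h))" using s h by (simp add: l_def)
  finally show ?thesis using l unfolding m_def h_def by simp
qed

lemma expectation_max_abs_net_le:
  fixes Z :: "'j \<Rightarrow> 'a \<Rightarrow> real"
  assumes T: "finite T" "T \<noteq> {}" and N: "finite N" and s: "0 < s"
    and int: "\<And>t. t \<in> T \<union> N \<Longrightarrow> integrable M (Z t)"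
    and net: "\<And>t. t \<in> T \<Longrightarrow> \<exists>u\<in>N. subgaussian s (\<lambda>\<omega>. Z t \<omega> - Z u \<omega>)"
  shows "expectation (\<lambda>\<omega>. max_abs T (\<lambda>t. Z t \<omega>))
    \<le> expectation (\<lambda>\<omega>. max_abs N (\<lambda>t. Z t \<omega>)) + s * sqrt (2 * ln (2 * real (card T)))"
proof -
  obtain p where p: "\<And>t. t \<in> T \<Longrightarrow> p t \<in> N \<and> subgaussian s (\<lambda>\<omega>. Z t \<omega> - Z (p t) \<omega>)"
    using net by metis
  have N_ne: "N \<noteq> {}" using T(2) p by auto
  have max_le: "max_abs T (\<lambda>t. Z t \<omega>) \<le> max_abs N (\<lambda>t. Z t \<omega>) + max_abs T (\<lambda>t. Z t \<omega> - Z (p t) \<omega>)"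
    for \<omega>
  proof -
    have "max_abs T (\<lambda>t. Z t \<omega>) = max_abs T (\<lambda>t. Z (p t) \<omega> + (Z t \<omega> - Z (p t) \<omega>))" by simp
    also have "\<dots> \<le> max_abs T (\<lambda>t. Z (p t) \<omega>) + max_abs T (\<lambda>t. Z t \<omega> - Z (p t) \<omega>)"
      by (rule max_abs_add_le[OF T])
    also have "max_abs T (\<lambda>t. Z (p t) \<omega>) \<le> max_abs N (\<lambda>t. Z t \<omega>)"
      using p N by (intro max_abs_le[OF T] abs_le_max_abs[of N _ "\<lambda>t. Z t \<omega>"]) auto
    finally show ?thesis by simp
  qed
  have max_int: "integrable M (\<lambda>\<omega>. max_abs T (\<lambda>t. Z t \<omega>))"
      "integrable M (\<lambda>\<omega>. max_abs N (\<lambda>t. Z t \<omega>))"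
      "integrable M (\<lambda>\<omega>. max_abs T (\<lambda>t. Z t \<omega> - Z (p t) \<omega>))"
    using T N N_ne int p by (auto intro!: integrable_max_abs intro: integrable_subgaussian)
  have "expectation (\<lambda>\<omega>. max_abs T (\<lambda>t. Z t \<omega>))
      \<le> expectation (\<lambda>\<omega>. max_abs N (\<lambda>t. Z t \<omega>) + max_abs T (\<lambda>t. Z t \<omega> - Z (p t) \<omega>))"
    using max_int max_le by (intro integral_mono) auto
  also have "\<dots> = expectation (\<lambda>\<omega>. max_abs N (\<lambda>t. Z t \<omega>))
      + expectation (\<lambda>\<omega>. max_abs T (\<lambda>t. Z t \<omega> - Z (p t) \<omega>))"
    using max_int by simp
  also have "expectation (\<lambda>\<omega>. max_abs T (\<lambda>t. Z t \<omega> - Z (p t) \<omega>))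
      \<le> s * sqrt (2 * ln (2 * real (card T)))"
    using T s p by (intro expectation_max_abs_subgaussian_le) auto
  finally show ?thesis by simp
qed

end

lemma exists_separated_net:
  fixes d :: "'j \<Rightarrow> 'j \<Rightarrow> real"
  assumes J: "finite J" and refl: "\<And>t. d t t \<le> e" and sym: "\<And>t u. d t u = d u t"
  shows "\<exists>N\<subseteq>J. pairwise (\<lambda>t u. e < d t u) N \<and> (\<forall>t\<in>J. \<exists>u\<in>N. d t u \<le> e)"
proof -
  define separated where "separated = {N. N \<subseteq> J \<and> pairwise (\<lambda>t u. e < d t u) N}"
  have "finite separated" "{} \<in> separated" using J by (simp_all add: separated_def)
  then obtain N where N: "N \<in> separated" "\<forall>N'\<in>separated. N \<subseteq> N' \<longrightarrow> N = N'"
    using finite_has_maximal[of separated] by auto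
  have "\<exists>u\<in>N. d t u \<le> e" if t: "t \<in> J" for t
  proof (rule ccontr)
    assume far: "\<not> (\<exists>u\<in>N. d t u \<le> e)"
    then have "insert t N \<in> separated"
      using N(1) t sym[of t] by (auto simp: separated_def pairwise_insert not_le)
    then have "t \<in> N" using N(2) by blast
    then show False using far refl by blast
  qed
  then show ?thesis using N(1) by (auto simp: separated_def)
qed

lemma (in prob_space) expectation_max_abs_nets_le:
  fixes Z :: "'j \<Rightarrow> 'a \<Rightarrow> real" and N :: "nat \<Rightarrow> 'j set" and H :: "nat \<Rightarrow> real"
  assumes J: "finite J" "J \<noteq> {}" and r: "0 < r"
    and sub: "\<And>t. t \<in> J \<Longrightarrow> subgaussian r (Z t)"
    and N: "\<And>k. N k \<subseteq> J"
    and net: "\<And>k t. t \<in> J \<Longrightarrow> \<exists>u\<in>N k. subgaussian (r / 4 ^ k) (\<lambda>\<omega>. Z t \<omega> - Z u \<omega>)"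
    and entropy: "\<And>k. sqrt (2 * ln (2 * real (card (N k)))) \<le> H k"
  shows "expectation (\<lambda>\<omega>. max_abs J (\<lambda>t. Z t \<omega>))
    \<le> r * (\<Sum>k\<le>K. H (Suc k) / 4 ^ k) + r / 4 ^ Suc K * sqrt (2 * ln (2 * real (card J)))"
proof -
  define E where "E T = expectation (\<lambda>\<omega>. max_abs T (\<lambda>t. Z t \<omega>))" for T
  have finite_sub: "finite T" if "T \<subseteq> J" for T using J(1) that by (rule rev_finite_subset)
  have N_ne: "N k \<noteq> {}" for k using J(2) net by fast
  have refine: "E T \<le> E (N k) + r / 4 ^ k * sqrt (2 * ln (2 * real (card T)))"
    if T: "T \<subseteq> J" "T \<noteq> {}" for T k
    unfolding E_def
  proof (rule expectation_max_abs_net_le)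
    show "integrable M (Z t)" if "t \<in> T \<union> N k" for t
      using that T(1) N by (intro integrable_subgaussian[OF sub]) auto
    show "\<exists>u\<in>N k. subgaussian (r / 4 ^ k) (\<lambda>\<omega>. Z t \<omega> - Z u \<omega>)" if "t \<in> T" for t
      using that T(1) by (intro net) auto
  qed (use T finite_sub N r in auto)
  have "E (N (Suc K)) \<le> r * (\<Sum>k\<le>K. H (Suc k) / 4 ^ k)"
  proof (induction K)
    case 0
    have "E (N (Suc 0)) \<le> r * sqrt (2 * ln (2 * real (card (N (Suc 0)))))"
      unfolding E_def using N N_ne sub r
      by (intro expectation_max_abs_subgaussian_le) (auto intro: finite_sub)
    also have "\<dots> \<le> r * H (Suc 0)" using entropy r by (intro mult_left_mono) auto
    finally show ?case by simp
  next
    case (Suc K)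
    have "E (N (Suc (Suc K)))
        \<le> E (N (Suc K)) + r / 4 ^ Suc K * sqrt (2 * ln (2 * real (card (N (Suc (Suc K))))))"
      by (rule refine[OF N N_ne])
    also have "\<dots> \<le> r * (\<Sum>k\<le>K. H (Suc k) / 4 ^ k) + r / 4 ^ Suc K * H (Suc (Suc K))"
      using entropy r by (intro add_mono Suc.IH mult_left_mono) auto
    finally show ?case by (simp add: distrib_left)
  qed
  then show ?thesis using refine[OF subset_refl J(2), of "Suc K"] unfolding E_def by linarith
qed

text \<open>Dudley's entropy bound, with \<open>H k\<close> controlling the entropy at scale \<open>r / 4\<^sup>k\<close>.\<close>

lemma (in prob_space) expectation_max_abs_chaining_le:
  fixes Z :: "'j \<Rightarrow> 'a \<Rightarrow> real" and d :: "'j \<Rightarrow> 'j \<Rightarrow> real" and H :: "nat \<Rightarrow> real"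
  assumes J: "finite J" "J \<noteq> {}" and r: "0 < r"
    and d: "\<And>t. d t t = 0" "\<And>t u. d t u = d u t" "\<And>t u. 0 \<le> d t u"
    and sub: "\<And>t. t \<in> J \<Longrightarrow> subgaussian r (Z t)"
    and incr: "\<And>t u. t \<in> J \<Longrightarrow> u \<in> J \<Longrightarrow> subgaussian (d t u) (\<lambda>\<omega>. Z t \<omega> - Z u \<omega>)"
    and entropy: "\<And>k T. T \<subseteq> J \<Longrightarrow> T \<noteq> {} \<Longrightarrow> pairwise (\<lambda>t u. r / 4 ^ k < d t u) T
      \<Longrightarrow> sqrt (2 * ln (2 * real (card T))) \<le> H k"
    and bound: "\<And>K. (\<Sum>k\<le>K. H (Suc k) / 4 ^ k) \<le> B"
  shows "expectation (\<lambda>\<omega>. max_abs J (\<lambda>t. Z t \<omega>)) \<le> r * B"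
proof -
  let ?E = "expectation (\<lambda>\<omega>. max_abs J (\<lambda>t. Z t \<omega>))" and ?H = "sqrt (2 * ln (2 * real (card J)))"
  have "\<exists>N\<subseteq>J. pairwise (\<lambda>t u. r / 4 ^ k < d t u) N \<and> (\<forall>t\<in>J. \<exists>u\<in>N. d t u \<le> r / 4 ^ k)" for k :: nat
    using r by (intro exists_separated_net[OF J(1)]) (simp add: d(1), rule d(2))
  then obtain N where N: "\<And>k. N k \<subseteq> J" "\<And>k. pairwise (\<lambda>t u. r / 4 ^ k < d t u) (N k)"
    "\<And>k t. t \<in> J \<Longrightarrow> \<exists>u\<in>N k. d t u \<le> r / 4 ^ k"
    by metis
  have N_ne: "N k \<noteq> {}" for k using J(2) N(3) by fast
  have net: "\<exists>u\<in>N k. subgaussian (r / 4 ^ k) (\<lambda>\<omega>. Z t \<omega> - Z u \<omega>)" if t: "t \<in> J" for k t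
  proof -
    obtain u where "u \<in> N k" "d t u \<le> r / 4 ^ k" using N(3)[OF t] by blast
    then show ?thesis using incr[OF t] N(1) d(3) by (blast intro: subgaussian_mono)
  qed
  have "?E \<le> r * B + r * ?H * (1 / 4) ^ Suc K" for K
  proof -
    have "?E \<le> r * (\<Sum>k\<le>K. H (Suc k) / 4 ^ k) + r / 4 ^ Suc K * ?H"
      using N_ne by (intro expectation_max_abs_nets_le[OF J r sub N(1) net] entropy N)
    also have "r * (\<Sum>k\<le>K. H (Suc k) / 4 ^ k) \<le> r * B" using bound r by (intro mult_left_mono) auto
    finally show ?thesis by (simp add: power_one_over)
  qed
  moreover have "(\<lambda>K. r * B + r * ?H * (1 / 4) ^ Suc K) \<longlonglongrightarrow> r * B + r * ?H * 0"
    by (intro tendsto_intros LIMSEQ_Suc LIMSEQ_power_zero) auto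
  ultimately have "?E \<le> r * B + r * ?H * 0" by (intro LIMSEQ_le_const) auto
  then show ?thesis by simp
qed

subsection \<open>Rademacher averages of VC-subgraph classes\<close>

definition rademacher :: "'i set \<Rightarrow> ('i \<Rightarrow> real) pmf" where
  "rademacher I = Pi_pmf I 0 (\<lambda>_. pmf_of_set {-1, 1})"

abbreviation rademacher_average :: "'i set \<Rightarrow> (('i \<Rightarrow> real) \<Rightarrow> real) \<Rightarrow> real" where
  "rademacher_average I \<equiv> measure_pmf.expectation (rademacher I)"

lemma finite_set_pmf_rademacher: "finite I \<Longrightarrow> finite (set_pmf (rademacher I))"
  unfolding rademacher_def by (simp add: set_Pi_pmf finite_PiE_dflt)

lemma integrable_rademacher:
  fixes h :: "('i \<Rightarrow> real) \<Rightarrow> real"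
  shows "finite I \<Longrightarrow> integrable (rademacher I) h"
  by (intro integrable_measure_pmf_finite finite_set_pmf_rademacher)

lemma rademacher_average_insert:
  fixes h :: "('i \<Rightarrow> real) \<Rightarrow> real"
  assumes "finite I" "k \<notin> I"
  shows "rademacher_average (insert k I) h
    = rademacher_average I (\<lambda>\<epsilon>. (h (\<epsilon>(k := 1)) + h (\<epsilon>(k := -1))) / 2)"
proof -
  have "rademacher (insert k I) = pmf_of_set {-1, 1} \<bind> (\<lambda>s. map_pmf (\<lambda>\<epsilon>. \<epsilon>(k := s)) (rademacher I))"
    using assms by (simp add: rademacher_def Pi_pmf_insert' map_pmf_def)
  also have "measure_pmf.expectation \<dots> h = (rademacher_average I (\<lambda>\<epsilon>. h (\<epsilon>(k := 1)))
      + rademacher_average I (\<lambda>\<epsilon>. h (\<epsilon>(k := -1)))) / 2"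
    using finite_set_pmf_rademacher[OF assms(1)]
    by (subst pmf_expectation_bind_pmf_of_set) (simp_all add: add_divide_distrib add.commute)
  also have "\<dots> = rademacher_average I (\<lambda>\<epsilon>. (h (\<epsilon>(k := 1)) + h (\<epsilon>(k := -1))) / 2)"
    using integrable_rademacher[OF assms(1)] by simp
  finally show ?thesis .
qed

lemma cosh_le_exp_half_square: "cosh (y::real) \<le> exp (y\<^sup>2 / 2)"
proof -
  have pos: "cosh y \<le> exp (y\<^sup>2 / 2)" if y: "y \<ge> 0" for y :: real
  proof -
    have "- (2 * y) * (1/2) + ln (1 + (1/2) * (exp (2 * y) - 1)) \<le> (2 * y)\<^sup>2 / 8"
      using y by (intro Hoeffdings_lemma_aux) auto
    moreover have "1 + (1/2) * (exp (2 * y) - 1) = exp y * cosh y"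
      by (simp add: cosh_def field_simps exp_minus mult_exp_exp)
    moreover have "ln (exp y * cosh y) = y + ln (cosh y)" by (simp add: ln_mult)
    ultimately have "ln (cosh y) \<le> y\<^sup>2 / 2" by (simp add: power_mult_distrib)
    then show ?thesis using cosh_real_pos[of y] by (metis exp_le_cancel_iff exp_ln)
  qed
  show ?thesis using pos[of y] pos[of "- y"] by (cases "y \<ge> 0") auto
qed

lemma subgaussian_rademacher_sum:
  fixes a :: "'i \<Rightarrow> real"
  assumes I: "finite I" and s: "0 \<le> s" "(\<Sum>i\<in>I. (a i)\<^sup>2) \<le> s\<^sup>2"
  shows "measure_pmf.subgaussian (rademacher I) s (\<lambda>\<epsilon>. \<Sum>i\<in>I. \<epsilon> i * a i)"
  unfolding measure_pmf.subgaussian_def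
proof (intro allI conjI)
  fix l :: real
  show "integrable (rademacher I) (\<lambda>\<epsilon>. exp (l * (\<Sum>i\<in>I. \<epsilon> i * a i)))"
    using I by (rule integrable_rademacher)
  have "rademacher_average I (\<lambda>\<epsilon>. exp (l * (\<Sum>i\<in>I. \<epsilon> i * a i)))
      = rademacher_average I (\<lambda>\<epsilon>. \<Prod>i\<in>I. exp (\<epsilon> i * (l * a i)))"
    using I by (simp add: exp_sum sum_distrib_left mult_ac)
  also have "\<dots> = (\<Prod>i\<in>I. measure_pmf.expectation (pmf_of_set {-1, 1}) (\<lambda>v. exp (v * (l * a i))))"
    unfolding rademacher_def using I
    by (intro expectation_prod_Pi_pmf) (auto intro!: integrable_measure_pmf_finite)
  also have "\<dots> = (\<Prod>i\<in>I. cosh (l * a i))"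
    by (simp add: integral_pmf_of_set cosh_def add.commute)
  also have "\<dots> \<le> (\<Prod>i\<in>I. exp ((l * a i)\<^sup>2 / 2))"
    by (intro prod_mono) (auto simp: cosh_le_exp_half_square)
  also have "\<dots> = exp (l\<^sup>2 * (\<Sum>i\<in>I. (a i)\<^sup>2) / 2)"
    using I by (simp add: exp_sum sum_divide_distrib sum_distrib_left power_mult_distrib)
  also have "\<dots> \<le> exp ((l * s)\<^sup>2 / 2)"
    using s(2) by (simp add: power_mult_distrib mult_left_mono)
  finally show "rademacher_average I (\<lambda>\<epsilon>. exp (l * (\<Sum>i\<in>I. \<epsilon> i * a i))) \<le> exp ((l * s)\<^sup>2 / 2)" .
qed

lemma subgaussian_rademacher_sum_of_abs_le:
  fixes a b :: "'i \<Rightarrow> real"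
  assumes I: "finite I" and l: "0 \<le> l" and ab: "\<And>i. i \<in> I \<Longrightarrow> \<bar>a i\<bar> \<le> l * \<bar>b i\<bar>"
  shows "measure_pmf.subgaussian (rademacher I) (l * sqrt (real (card I) * mean_square I b))
    (\<lambda>\<epsilon>. \<Sum>i\<in>I. \<epsilon> i * a i)"
proof (rule subgaussian_rademacher_sum[OF I])
  have "(a i)\<^sup>2 \<le> l\<^sup>2 * (b i)\<^sup>2" if "i \<in> I" for i
    using power_mono[OF ab[OF that], of 2] by (simp add: power_mult_distrib)
  then have "(\<Sum>i\<in>I. (a i)\<^sup>2) \<le> l\<^sup>2 * (\<Sum>i\<in>I. (b i)\<^sup>2)"
    unfolding sum_distrib_left by (rule sum_mono)
  then show "(\<Sum>i\<in>I. (a i)\<^sup>2) \<le> (l * sqrt (real (card I) * mean_square I b))\<^sup>2"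
    by (simp add: card_times_mean_square power_mult_distrib sum_nonneg)
qed (use l in \<open>simp add: mean_square_nonneg\<close>)

lemma rademacher_average_chaining_le:
  fixes a b :: "'j \<Rightarrow> 'i \<Rightarrow> real" and l s B :: real
  assumes I: "finite I" "I \<noteq> {}" and J: "finite J" "J \<noteq> {}" and s: "0 < s" and l: "0 < l"
    and mean_square_le: "\<And>j. j \<in> J \<Longrightarrow> mean_square I (a j) \<le> s"
    and dominated: "\<And>j i. j \<in> J \<Longrightarrow> i \<in> I \<Longrightarrow> \<bar>b j i\<bar> \<le> l * \<bar>a j i\<bar>"
    and lipschitz: "\<And>j j' i. j \<in> J \<Longrightarrow> j' \<in> J \<Longrightarrow> i \<in> I
      \<Longrightarrow> \<bar>b j i - b j' i\<bar> \<le> l * \<bar>a j i - a j' i\<bar>"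
    and entropy: "\<And>k T. T \<subseteq> J \<Longrightarrow> T \<noteq> {}
      \<Longrightarrow> pairwise (\<lambda>j j'. s / 16 ^ k < mean_square I (\<lambda>i. a j i - a j' i)) T
      \<Longrightarrow> sqrt (2 * ln (2 * real (card T))) \<le> H k"
    and bound: "\<And>K. (\<Sum>k\<le>K. H (Suc k) / 4 ^ k) \<le> B"
  shows "rademacher_average I (\<lambda>\<epsilon>. max_abs J (\<lambda>j. \<Sum>i\<in>I. \<epsilon> i * b j i))
    \<le> l * sqrt (real (card I) * s) * B"
proof -
  define n where "n = real (card I)"
  have n: "n > 0" using I by (simp add: n_def card_gt_0_iff)
  define d where "d j j' = l * sqrt (n * mean_square I (\<lambda>i. a j i - a j' i))" for j j'
  define r where "r = l * sqrt (n * s)"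
  have "rademacher_average I (\<lambda>\<epsilon>. max_abs J (\<lambda>j. \<Sum>i\<in>I. \<epsilon> i * b j i)) \<le> r * B"
  proof (rule measure_pmf.expectation_max_abs_chaining_le
        [where d = d, OF J _ _ _ _ _ _ entropy bound])
    show "0 < r" using l n s by (simp add: r_def)
    show "d j j = 0" "d j j' = d j' j" "0 \<le> d j j'" for j j'
      using l n
      by (simp_all add: d_def mean_square_nonneg mean_square_def power2_commute sum_nonneg)
    show "measure_pmf.subgaussian (rademacher I) r (\<lambda>\<epsilon>. \<Sum>i\<in>I. \<epsilon> i * b j i)" if j: "j \<in> J" for j
    proof (rule measure_pmf.subgaussian_mono)
      show "measure_pmf.subgaussian (rademacher I) (l * sqrt (n * mean_square I (a j)))
          (\<lambda>\<epsilon>. \<Sum>i\<in>I. \<epsilon> i * b j i)"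
        unfolding n_def using dominated[OF j] l
        by (intro subgaussian_rademacher_sum_of_abs_le I) auto
      show "l * sqrt (n * mean_square I (a j)) \<le> r"
        unfolding r_def using mean_square_le[OF j] l n
        by (intro mult_left_mono real_sqrt_le_mono) auto
    qed (use l n in \<open>simp add: mean_square_nonneg\<close>)
    show "measure_pmf.subgaussian (rademacher I) (d j j')
        (\<lambda>\<epsilon>. (\<Sum>i\<in>I. \<epsilon> i * b j i) - (\<Sum>i\<in>I. \<epsilon> i * b j' i))" if "j \<in> J" "j' \<in> J" for j j'
    proof -
      have "measure_pmf.subgaussian (rademacher I) (d j j') (\<lambda>\<epsilon>. \<Sum>i\<in>I. \<epsilon> i * (b j i - b j' i))"
        unfolding d_def n_def using lipschitz[OF that] l
        by (intro subgaussian_rademacher_sum_of_abs_le I) auto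
      then show ?thesis by (simp add: right_diff_distrib sum_subtractf)
    qed
    show "pairwise (\<lambda>j j'. s / 16 ^ k < mean_square I (\<lambda>i. a j i - a j' i)) T"
      if "pairwise (\<lambda>j j'. r / 4 ^ k < d j j') T" for k T
    proof -
      have "(16::real) ^ k = (4 ^ k)\<^sup>2" by (simp add: power2_eq_square power_mult_distrib[symmetric])
      then have "r / 4 ^ k = l * sqrt (n * (s / 16 ^ k))" by (simp add: r_def real_sqrt_divide)
      then have "r / 4 ^ k < d j j' \<longleftrightarrow> s / 16 ^ k < mean_square I (\<lambda>i. a j i - a j' i)" for j j'
        unfolding d_def using l n by (simp only: mult_less_cancel_left_pos real_sqrt_less_iff)
      then show ?thesis using that by simp
    qed
  qed
  then show ?thesis by (simp add: r_def n_def)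
qed

text \<open>Cauchy--Schwarz with the weights \<open>4\<^sup>-\<^sup>k\<close>, where \<open>\<Sum> 4\<^sup>-\<^sup>k = 4/3\<close> and
  \<open>\<Sum> (k + 1) 4\<^sup>-\<^sup>k = 16/9\<close>.\<close>

lemma sum_sqrt_affine_power4_le:
  fixes p q :: real
  assumes "0 \<le> p" "0 \<le> q"
  shows "(\<Sum>k\<le>K. sqrt (p + q * real (Suc k)) / 4 ^ k) \<le> 4 / 3 * sqrt (p + 4 / 3 * q)"
proof -
  let ?y = "\<lambda>k. p + q * real (Suc k)"
  have y: "0 \<le> ?y k" for k using assms by simp
  have geometric: "(\<Sum>k\<le>K. (1 / 4) ^ k) \<le> (4 / 3 :: real)"
  proof -
    have "(\<Sum>k\<le>K. (1 / 4) ^ k) \<le> (\<Sum>k. (1 / 4) ^ k :: real)"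
      by (intro sum_le_suminf summable_geometric) auto
    also have "\<dots> = 4 / 3" by (subst suminf_geometric) auto
    finally show ?thesis .
  qed
  have weighted: "(\<Sum>k\<le>K. real (Suc k) * (1 / 4) ^ k) \<le> 16 / 9"
  proof -
    have sums: "(\<lambda>k. real (Suc k) * (1 / 4) ^ k) sums (16 / 9)"
      using geometric_deriv_sums[of "1 / 4 :: real"] by (simp add: power2_eq_square)
    then have "(\<Sum>k\<le>K. real (Suc k) * (1 / 4) ^ k) \<le> (\<Sum>k. real (Suc k) * (1 / 4) ^ k)"
      by (intro sum_le_suminf sums_summable[OF sums]) auto
    also have "\<dots> = 16 / 9" using sums by (rule sums_unique[symmetric])
    finally show ?thesis .
  qed
  have half: "((1 / 2) ^ k :: real)\<^sup>2 = (1 / 4) ^ k" for k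
    by (simp add: power2_eq_square flip: power_mult_distrib)
  have "(\<Sum>k\<le>K. sqrt (?y k) / 4 ^ k) = (\<Sum>k\<le>K. (1 / 2) ^ k * ((1 / 2) ^ k * sqrt (?y k)))"
    by (simp only: half mult.assoc[symmetric] power2_eq_square[symmetric])
      (simp add: power_one_over)
  also have "(\<dots>)\<^sup>2 \<le> (\<Sum>k\<le>K. ((1 / 2) ^ k)\<^sup>2) * (\<Sum>k\<le>K. ((1 / 2) ^ k * sqrt (?y k))\<^sup>2)"
    by (rule Cauchy_Schwarz_ineq_sum)
  also have "\<dots> = (\<Sum>k\<le>K. (1 / 4) ^ k) * (\<Sum>k\<le>K. (1 / 4) ^ k * ?y k)"
    using y by (simp add: half power_mult_distrib)
  also have "(\<Sum>k\<le>K. (1 / 4) ^ k * ?y k)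
      = p * (\<Sum>k\<le>K. (1 / 4) ^ k) + q * (\<Sum>k\<le>K. real (Suc k) * (1 / 4) ^ k)"
    by (simp add: sum_distrib_left sum.distrib[symmetric] algebra_simps)
  also have "(\<Sum>k\<le>K. (1 / 4) ^ k) * \<dots> \<le> 4 / 3 * (p * (4 / 3) + q * (16 / 9))"
    using geometric weighted assms
    by (intro mult_mono add_mono mult_left_mono)
      (auto intro!: add_nonneg_nonneg mult_nonneg_nonneg sum_nonneg)
  also have "\<dots> = (4 / 3 * sqrt (p + 4 / 3 * q))\<^sup>2"
    unfolding power_mult_distrib using assms by (simp add: power2_eq_square algebra_simps)
  finally show ?thesis by (rule power2_le_imp_le) (use assms in simp)
qed

text \<open>The paper's \<open>\<L>(\<sigma>)\<close> is \<open>log_factor (\<sigma>\<^sup>2)\<close>.\<close>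

definition log_factor :: "real \<Rightarrow> real" where
  "log_factor s = 9.11 + ln (1 / s)"

lemma sum_sqrt_entropy_le:
  assumes "0 < s" "s \<le> 1"
  shows "(\<Sum>k\<le>K. sqrt (241 / 18 + 3 * ln (1 / s) + 25 / 3 * real (Suc k)) / 4 ^ k)
      \<le> 2.37 * sqrt (log_factor s)"
proof -
  define u where "u = ln (1 / s)"
  have u: "0 \<le> u" using assms by (simp add: u_def)
  have "(\<Sum>k\<le>K. sqrt (241 / 18 + 3 * u + 25 / 3 * real (Suc k)) / 4 ^ k)
      \<le> 4 / 3 * sqrt (241 / 18 + 3 * u + 4 / 3 * (25 / 3))"
    using u by (intro sum_sqrt_affine_power4_le) auto
  also have "\<dots> = sqrt (16 / 9 * (49 / 2 + 3 * u))"
    unfolding real_sqrt_mult by (simp add: real_sqrt_divide)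
  also have "\<dots> \<le> sqrt (2.37\<^sup>2 * (9.11 + u))"
    using u by (intro real_sqrt_le_mono) (simp add: power2_eq_square field_simps)
  also have "\<dots> = 2.37 * sqrt (log_factor s)" by (simp add: real_sqrt_mult log_factor_def u_def)
  finally show ?thesis by (simp add: u_def)
qed

text \<open>The constants come from \<open>2 (ln 2 + V (6 + 3/2 ln (1/e)))\<close> with \<open>e = s / 16\<^sup>k\<close> and
  \<open>ln 2 \<le> 25/36\<close>.\<close>

lemma sqrt_ln_packing_le:
  fixes x :: "'i \<Rightarrow> 'a" and s V :: real
  assumes I: "finite I" "I \<noteq> {}" and x: "\<And>i. i \<in> I \<Longrightarrow> x i \<in> X"
    and T: "finite T" "T \<noteq> {}" and s: "0 < s" "s \<le> 1"
    and bnd: "\<And>f i. f \<in> T \<Longrightarrow> i \<in> I \<Longrightarrow> \<bar>f (x i)\<bar> \<le> 1"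
    and sep: "pairwise (\<lambda>f g. s / 16 ^ k < mean_square I (\<lambda>i. f (x i) - g (x i))) T"
    and VC: "VC_subgraph_le X T V" and V: "1 \<le> V"
  shows "sqrt (2 * ln (2 * real (card T)))
      \<le> sqrt V * sqrt (241 / 18 + 3 * ln (1 / s) + 25 / 3 * real k)"
proof -
  have "1 * s \<le> 16 ^ k * 1" using s by (intro mult_mono) auto
  then have e: "0 < s / 16 ^ k" "s / 16 ^ k \<le> 1" using s(1) by simp_all
  have "ln (real (card T)) \<le> V * (6 + 3 / 2 * ln (1 / (s / 16 ^ k)))"
    by (rule ln_packing_le[OF I _ T e _ sep VC V]) (use x bnd in auto)
  also have "ln (1 / (s / 16 ^ k)) \<le> ln (1 / s) + real k * (25 / 9)"
  proof -
    have "ln (1 / (s / 16 ^ k)) = ln (1 / s) + real k * ln (2 ^ 4)"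
      using s(1) by (simp add: ln_div ln_realpow)
    also have "ln ((2::real) ^ 4) = 4 * ln 2" by (subst ln_realpow) auto
    also have "real k * (4 * ln 2) \<le> real k * (25 / 9)"
      using ln2_le_25_over_36 by (intro mult_left_mono) auto
    finally show ?thesis by simp
  qed
  finally have "ln (real (card T)) \<le> V * (6 + 3 / 2 * (ln (1 / s) + real k * (25 / 9)))"
    using V by (simp add: mult_left_mono)
  moreover have "ln 2 \<le> V * (25 / 36)" using V ln2_le_25_over_36 by simp
  moreover have "ln (2 * real (card T)) = ln 2 + ln (real (card T))"
    using T by (simp add: ln_mult card_gt_0_iff)
  ultimately have "2 * ln (2 * real (card T)) \<le> V * (241 / 18 + 3 * ln (1 / s) + 25 / 3 * real k)"
    by (simp add: algebra_simps)
  then show ?thesis unfolding real_sqrt_mult[symmetric] by (rule real_sqrt_le_mono)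
qed

lemma rademacher_average_VC_subgraph_le_of_pos:
  fixes x :: "'i \<Rightarrow> 'a" and \<phi> :: "real \<Rightarrow> real" and V l s :: real
  assumes I: "finite I" "I \<noteq> {}" and x: "\<And>i. i \<in> I \<Longrightarrow> x i \<in> X"
    and J: "finite J" "J \<noteq> {}" and VC: "VC_subgraph_le X J V" and V: "1 \<le> V"
    and bnd: "\<And>f i. f \<in> J \<Longrightarrow> i \<in> I \<Longrightarrow> \<bar>f (x i)\<bar> \<le> 1"
    and s: "0 < s" "s \<le> 1" and mean_square_le: "\<And>f. f \<in> J \<Longrightarrow> mean_square I (\<lambda>i. f (x i)) \<le> s"
    and \<phi>0: "\<phi> 0 = 0" and l: "0 < l"
    and lip: "\<And>a b. \<bar>a\<bar> \<le> 1 \<Longrightarrow> \<bar>b\<bar> \<le> 1 \<Longrightarrow> \<bar>\<phi> a - \<phi> b\<bar> \<le> l * \<bar>a - b\<bar>"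
  shows "rademacher_average I (\<lambda>\<epsilon>. max_abs J (\<lambda>f. \<Sum>i\<in>I. \<epsilon> i * \<phi> (f (x i))))
      \<le> l * (2.37 * sqrt (real (card I) * V * (s * log_factor s)))"
proof -
  have "rademacher_average I (\<lambda>\<epsilon>. max_abs J (\<lambda>f. \<Sum>i\<in>I. \<epsilon> i * \<phi> (f (x i))))
      \<le> l * sqrt (real (card I) * s) * (sqrt V * (2.37 * sqrt (log_factor s)))"
  proof (rule rademacher_average_chaining_le[where a = "\<lambda>f i. f (x i)"])
    show "\<bar>\<phi> (f (x i))\<bar> \<le> l * \<bar>f (x i)\<bar>" if "f \<in> J" "i \<in> I" for f i
      using lip[OF bnd[OF that], of 0] \<phi>0 by simp
    show "\<bar>\<phi> (f (x i)) - \<phi> (g (x i))\<bar> \<le> l * \<bar>f (x i) - g (x i)\<bar>" if "f \<in> J" "g \<in> J" "i \<in> I"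
      for f g i
      using that by (intro lip bnd)
    show "sqrt (2 * ln (2 * real (card T)))
        \<le> sqrt V * sqrt (241 / 18 + 3 * ln (1 / s) + 25 / 3 * real k)"
      if T: "T \<subseteq> J" "T \<noteq> {}"
        and sep: "pairwise (\<lambda>f g. s / 16 ^ k < mean_square I (\<lambda>i. f (x i) - g (x i))) T" for k T
      by (rule sqrt_ln_packing_le[OF I _ finite_subset[OF T(1) J(1)] T(2) s _ sep
            VC_subgraph_le_subset[OF VC T(1)] V])
        (use T(1) bnd x in auto)
    show "(\<Sum>k\<le>K. sqrt V * sqrt (241 / 18 + 3 * ln (1 / s) + 25 / 3 * real (Suc k)) / 4 ^ k)
        \<le> sqrt V * (2.37 * sqrt (log_factor s))" for K
      unfolding times_divide_eq_right[symmetric] sum_distrib_left[symmetric]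
      using V by (intro mult_left_mono sum_sqrt_entropy_le[OF s]) simp
  qed (use I J s l mean_square_le in auto)
  also have "\<dots> = l * (2.37 * sqrt (real (card I) * V * (s * log_factor s)))"
    by (simp only: real_sqrt_mult mult_ac)
  finally show ?thesis .
qed

lemma rademacher_average_VC_subgraph_le:
  fixes x :: "'i \<Rightarrow> 'a" and \<phi> :: "real \<Rightarrow> real" and V l :: real
  assumes I: "finite I" "I \<noteq> {}" and x: "\<And>i. i \<in> I \<Longrightarrow> x i \<in> X"
    and J: "finite J" "J \<noteq> {}" and VC: "VC_subgraph_le X J V" and V: "1 \<le> V"
    and bnd: "\<And>f i. f \<in> J \<Longrightarrow> i \<in> I \<Longrightarrow> \<bar>f (x i)\<bar> \<le> 1"
    and \<phi>0: "\<phi> 0 = 0" and l: "0 < l"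
    and lip: "\<And>a b. \<bar>a\<bar> \<le> 1 \<Longrightarrow> \<bar>b\<bar> \<le> 1 \<Longrightarrow> \<bar>\<phi> a - \<phi> b\<bar> \<le> l * \<bar>a - b\<bar>"
  defines "s \<equiv> max_abs J (\<lambda>f. mean_square I (\<lambda>i. f (x i)))"
  shows "rademacher_average I (\<lambda>\<epsilon>. max_abs J (\<lambda>f. \<Sum>i\<in>I. \<epsilon> i * \<phi> (f (x i))))
      \<le> l * (2.37 * sqrt (real (card I) * V * (s * log_factor s)))"
proof (cases "s = 0")
  case False
  have mean_square_le: "mean_square I (\<lambda>i. f (x i)) \<le> s" if "f \<in> J" for f
    using abs_le_max_abs[OF J(1) that, of "\<lambda>f. mean_square I (\<lambda>i. f (x i))"] by (simp add: s_def)
  have "s \<le> 1" unfolding s_def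
    using bnd by (intro max_abs_le J) (simp add: mean_square_nonneg mean_square_le_1)
  moreover have "0 < s" using False max_abs_nonneg[OF J] by (simp add: s_def less_le)
  ultimately show ?thesis
    using I x J VC V bnd mean_square_le \<phi>0 l lip by (intro rademacher_average_VC_subgraph_le_of_pos)
next
  case True
  have vanish: "f (x i) = 0" if "f \<in> J" "i \<in> I" for f i
  proof -
    have "mean_square I (\<lambda>i. f (x i)) = 0"
      using abs_le_max_abs[OF J(1) that(1), of "\<lambda>f. mean_square I (\<lambda>i. f (x i))"] True
      by (simp add: s_def)
    then have "(\<Sum>i\<in>I. (f (x i))\<^sup>2) = 0" using card_times_mean_square[of I "\<lambda>i. f (x i)"] by simp
    then show ?thesis using I(1) that(2) by (simp add: sum_nonneg_eq_0_iff)
  qed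
  have "(\<Sum>i\<in>I. \<epsilon> i * \<phi> (f (x i))) = 0" if "f \<in> J" for \<epsilon> f
    using vanish[OF that] \<phi>0 by (intro sum.neutral) simp
  then have "max_abs J (\<lambda>f. \<Sum>i\<in>I. \<epsilon> i * \<phi> (f (x i))) \<le> 0" for \<epsilon>
    by (intro max_abs_le J) simp
  then have "max_abs J (\<lambda>f. \<Sum>i\<in>I. \<epsilon> i * \<phi> (f (x i))) = 0" for \<epsilon>
    using max_abs_nonneg[OF J] by (intro antisym)
  then show ?thesis using True by simp
qed

subsection \<open>Symmetrization\<close>

lemma integrable_expectation_pmf:
  fixes g :: "'e \<Rightarrow> 'a \<Rightarrow> real"
  assumes p: "finite (set_pmf p)" and g: "\<And>e. e \<in> set_pmf p \<Longrightarrow> integrable M (g e)"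
  shows "integrable M (\<lambda>\<omega>. measure_pmf.expectation p (\<lambda>e. g e \<omega>))"
  using g by (subst integral_measure_pmf_real[OF p]) auto

lemma integral_expectation_pmf_swap:
  fixes g :: "'e \<Rightarrow> 'a \<Rightarrow> real"
  assumes p: "finite (set_pmf p)" and g: "\<And>e. e \<in> set_pmf p \<Longrightarrow> integrable M (g e)"
  shows "(\<integral>\<omega>. measure_pmf.expectation p (\<lambda>e. g e \<omega>) \<partial>M)
      = measure_pmf.expectation p (\<lambda>e. \<integral>\<omega>. g e \<omega> \<partial>M)"
  using g by (simp add: integral_measure_pmf_real[OF p] Bochner_Integration.integral_sum)

lemma measurable_comp_component:
  assumes "h \<in> measurable (S i) N" "i \<in> B"
  shows "(\<lambda>y. h (y i)) \<in> measurable (PiM B S) N"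
  by (rule measurable_compose[OF measurable_component_singleton[OF assms(2)]]) (rule assms(1))

context prob_space
begin

lemma indep_var_iterated_expectation:
  fixes f :: "'x \<times> 'x \<Rightarrow> real"
  assumes indep: "indep_var N Y S X" and f: "f \<in> borel_measurable (N \<Otimes>\<^sub>M S)"
    and int: "integrable M (\<lambda>\<omega>. f (Y \<omega>, X \<omega>))"
  shows "integrable M (\<lambda>\<omega>. expectation (\<lambda>\<eta>. f (Y \<omega>, X \<eta>)))"
    and "expectation (\<lambda>\<omega>. expectation (\<lambda>\<eta>. f (Y \<omega>, X \<eta>))) = expectation (\<lambda>\<omega>. f (Y \<omega>, X \<omega>))"
proof -
  have Y: "Y \<in> measurable M N" and X: "X \<in> measurable M S"
    and joint: "distr M N Y \<Otimes>\<^sub>M distr M S X = distr M (N \<Otimes>\<^sub>M S) (\<lambda>\<omega>. (Y \<omega>, X \<omega>))"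
    using indep by (simp_all add: indep_var_distribution_eq)
  interpret PY: prob_space "distr M N Y" by (rule prob_space_distr[OF Y])
  interpret PX: prob_space "distr M S X" by (rule prob_space_distr[OF X])
  interpret PYX: pair_sigma_finite "distr M N Y" "distr M S X" ..
  have YX: "(\<lambda>\<omega>. (Y \<omega>, X \<omega>)) \<in> measurable M (N \<Otimes>\<^sub>M S)" using Y X by simp
  define g where "g y = (\<integral>x. f (y, x) \<partial>distr M S X)" for y
  have f_int: "integrable (distr M N Y \<Otimes>\<^sub>M distr M S X) f"
    unfolding joint using int by (simp add: integrable_distr_eq[OF YX f])
  have g_int: "integrable (distr M N Y) g" unfolding g_def by (rule PYX.integrable_fst'[OF f_int])
  then have g_meas: "g \<in> borel_measurable N" by (simp add: integrable_iff_bounded)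
  have g_eq: "expectation (\<lambda>\<eta>. f (Y \<omega>, X \<eta>)) = g (Y \<omega>)" if "\<omega> \<in> space M" for \<omega>
    unfolding g_def using measurable_space[OF Y that] f X by (subst integral_distr) auto
  show "integrable M (\<lambda>\<omega>. expectation (\<lambda>\<eta>. f (Y \<omega>, X \<eta>)))"
    using g_int integrable_distr_eq[OF Y g_meas]
    by (simp add: g_eq cong: Bochner_Integration.integrable_cong)
  have "expectation (\<lambda>\<omega>. expectation (\<lambda>\<eta>. f (Y \<omega>, X \<eta>))) = (\<integral>y. g y \<partial>distr M N Y)"
    using integral_distr[OF Y g_meas] by (simp add: g_eq cong: Bochner_Integration.integral_cong)
  also have "\<dots> = (\<integral>z. f z \<partial>distr M (N \<Otimes>\<^sub>M S) (\<lambda>\<omega>. (Y \<omega>, X \<omega>)))"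
    unfolding g_def joint[symmetric] by (rule PYX.integral_fst'[OF f_int])
  also have "\<dots> = expectation (\<lambda>\<omega>. f (Y \<omega>, X \<omega>))" by (rule integral_distr[OF YX f])
  finally show "expectation (\<lambda>\<omega>. expectation (\<lambda>\<eta>. f (Y \<omega>, X \<eta>))) = expectation (\<lambda>\<omega>. f (Y \<omega>, X \<omega>))" .
qed

text \<open>\<open>c + (v - E h)\<close> is the midpoint of \<open>c + 2 v\<close> and \<open>E (c - 2 h)\<close>.\<close>

lemma max_abs_add_diff_expectation_le:
  fixes h :: "'j \<Rightarrow> 'a \<Rightarrow> real" and c v :: "'j \<Rightarrow> real"
  assumes J: "finite J" "J \<noteq> {}" and h: "\<And>j. j \<in> J \<Longrightarrow> integrable M (h j)"
  shows "max_abs J (\<lambda>j. c j + (v j - expectation (h j)))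
    \<le> (max_abs J (\<lambda>j. c j + 2 * v j) + expectation (\<lambda>\<omega>. max_abs J (\<lambda>j. c j - 2 * h j \<omega>))) / 2"
proof -
  have "max_abs J (\<lambda>j. c j + (v j - expectation (h j)))
      = max_abs J (\<lambda>j. 1 / 2 * ((c j + 2 * v j) + (c j - 2 * expectation (h j))))"
    by (intro arg_cong[where f = "max_abs J"] ext) (simp add: field_simps)
  also have "\<dots> = 1 / 2 * max_abs J (\<lambda>j. (c j + 2 * v j) + (c j - 2 * expectation (h j)))"
    by (subst max_abs_cmult[OF J]) simp
  also have "\<dots> \<le> 1 / 2 * (max_abs J (\<lambda>j. c j + 2 * v j)
      + max_abs J (\<lambda>j. c j - 2 * expectation (h j)))"
    by (intro mult_left_mono max_abs_add_le J) simp
  also have "max_abs J (\<lambda>j. c j - 2 * expectation (h j))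
      = max_abs J (\<lambda>j. expectation (\<lambda>\<omega>. c j - 2 * h j \<omega>))"
    unfolding max_abs_def using h
    by (intro arg_cong[where f = Max] image_cong) (simp_all add: prob_space)
  also have "\<dots> \<le> expectation (\<lambda>\<omega>. max_abs J (\<lambda>j. c j - 2 * h j \<omega>))"
    using h by (intro max_abs_integral_le J) simp
  finally show ?thesis by simp
qed

lemma symmetrization_indep_var:
  fixes c h :: "'j \<Rightarrow> 'x \<Rightarrow> real"
  assumes indep: "indep_var N Y S X" and J: "finite J" "J \<noteq> {}"
    and c: "\<And>j. j \<in> J \<Longrightarrow> c j \<in> borel_measurable N" "\<And>j. j \<in> J \<Longrightarrow> integrable M (\<lambda>\<omega>. c j (Y \<omega>))"
    and h: "\<And>j. j \<in> J \<Longrightarrow> h j \<in> borel_measurable S" "\<And>j. j \<in> J \<Longrightarrow> integrable M (\<lambda>\<omega>. h j (X \<omega>))"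
  shows "expectation (\<lambda>\<omega>. max_abs J (\<lambda>j. c j (Y \<omega>) + (h j (X \<omega>) - expectation (\<lambda>\<eta>. h j (X \<eta>)))))
    \<le> (expectation (\<lambda>\<omega>. max_abs J (\<lambda>j. c j (Y \<omega>) + 2 * h j (X \<omega>)))
      + expectation (\<lambda>\<omega>. max_abs J (\<lambda>j. c j (Y \<omega>) - 2 * h j (X \<omega>)))) / 2"
proof -
  let ?plus = "\<lambda>\<omega>. max_abs J (\<lambda>j. c j (Y \<omega>) + 2 * h j (X \<omega>))"
  let ?minus = "\<lambda>(y, x). max_abs J (\<lambda>j. c j y - 2 * h j x)"
  have plus_int: "integrable M ?plus" and minus_int: "integrable M (\<lambda>\<omega>. ?minus (Y \<omega>, X \<omega>))"
    and centered_int: "integrable M (\<lambda>\<omega>. max_abs J (\<lambda>j. c j (Y \<omega>)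
        + (h j (X \<omega>) - expectation (\<lambda>\<eta>. h j (X \<eta>)))))"
    using c(2) h(2) by (auto intro!: integrable_max_abs J)
  have "?minus \<in> borel_measurable (N \<Otimes>\<^sub>M S)"
    unfolding case_prod_unfold using c(1) h(1) J(1) by measurable
  note decouple = indep_var_iterated_expectation[OF indep this minus_int]
  have "expectation (\<lambda>\<omega>. max_abs J (\<lambda>j. c j (Y \<omega>) + (h j (X \<omega>) - expectation (\<lambda>\<eta>. h j (X \<eta>)))))
      \<le> expectation (\<lambda>\<omega>. (?plus \<omega> + expectation (\<lambda>\<eta>. ?minus (Y \<omega>, X \<eta>))) / 2)"
  proof (rule integral_mono[OF centered_int])
    show "integrable M (\<lambda>\<omega>. (?plus \<omega> + expectation (\<lambda>\<eta>. ?minus (Y \<omega>, X \<eta>))) / 2)"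
      using plus_int decouple(1) by simp
    show "max_abs J (\<lambda>j. c j (Y \<omega>) + (h j (X \<omega>) - expectation (\<lambda>\<eta>. h j (X \<eta>))))
        \<le> (?plus \<omega> + expectation (\<lambda>\<eta>. ?minus (Y \<omega>, X \<eta>))) / 2" for \<omega>
      unfolding prod.case by (rule max_abs_add_diff_expectation_le[OF J h(2)])
  qed
  also have "\<dots> = (expectation ?plus + expectation (\<lambda>\<omega>. ?minus (Y \<omega>, X \<omega>))) / 2"
    using plus_int decouple by simp
  finally show ?thesis by simp
qed

text \<open>Symmetrization proceeds one index at a time; \<open>A\<close> holds the indices already treated.\<close>

definition partially_symmetrized ::
    "'i set \<Rightarrow> ('i \<Rightarrow> 'j \<Rightarrow> 'a \<Rightarrow> real) \<Rightarrow> 'i set \<Rightarrow> ('i \<Rightarrow> real) \<Rightarrow> 'j \<Rightarrow> 'a \<Rightarrow> real" where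
  "partially_symmetrized I Z A \<epsilon> j \<omega> =
    (\<Sum>i\<in>A. \<epsilon> i * (2 * Z i j \<omega>)) + (\<Sum>i\<in>I - A. Z i j \<omega> - expectation (Z i j))"

lemma partially_symmetrized_remove:
  assumes "finite I" "k \<in> I" "k \<notin> A"
  shows "partially_symmetrized I Z A \<epsilon> j \<omega>
    = partially_symmetrized (I - {k}) Z A \<epsilon> j \<omega> + (Z k j \<omega> - expectation (Z k j))"
proof -
  have "I - A = insert k (I - {k} - A)" using assms(2,3) by auto
  then show ?thesis unfolding partially_symmetrized_def using assms(1) by simp
qed

lemma partially_symmetrized_insert:
  assumes "finite A" "k \<notin> A"
  shows "partially_symmetrized I Z (insert k A) (\<epsilon>(k := s)) j \<omega>
    = partially_symmetrized (I - {k}) Z A \<epsilon> j \<omega> + s * (2 * Z k j \<omega>)"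
proof -
  have "(\<Sum>i\<in>A. (\<epsilon>(k := s)) i * (2 * Z i j \<omega>)) = (\<Sum>i\<in>A. \<epsilon> i * (2 * Z i j \<omega>))"
    using assms(2) by (intro sum.cong) auto
  moreover have "I - insert k A = I - {k} - A" by auto
  ultimately show ?thesis unfolding partially_symmetrized_def using assms by simp
qed

lemma expectation_partially_symmetrized_le_insert:
  fixes X :: "'i \<Rightarrow> 'a \<Rightarrow> 'x" and h :: "'i \<Rightarrow> 'j \<Rightarrow> 'x \<Rightarrow> real" and \<epsilon> :: "'i \<Rightarrow> real"
  assumes indep: "indep_vars S X I" and I: "finite I" and J: "finite J" "J \<noteq> {}"
    and h: "\<And>i j. i \<in> I \<Longrightarrow> j \<in> J \<Longrightarrow> h i j \<in> borel_measurable (S i)"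
    and int: "\<And>i j. i \<in> I \<Longrightarrow> j \<in> J \<Longrightarrow> integrable M (\<lambda>\<omega>. h i j (X i \<omega>))"
    and A: "A \<subseteq> I" and k: "k \<in> I" "k \<notin> A"
  defines "E \<equiv> \<lambda>A \<epsilon>. expectation (\<lambda>\<omega>. max_abs J (\<lambda>j.
    partially_symmetrized I (\<lambda>i j \<omega>. h i j (X i \<omega>)) A \<epsilon> j \<omega>))"
  shows "E A \<epsilon> \<le> (E (insert k A) (\<epsilon>(k := 1)) + E (insert k A) (\<epsilon>(k := -1))) / 2"
proof -
  define R where "R = I - {k}"
  have R: "R \<subseteq> I" "A \<subseteq> R" using A k by (auto simp: R_def)
  define Y where "Y \<omega> = (\<lambda>i\<in>R. X i \<omega>)" for \<omega>
  define Xk where "Xk \<omega> = (\<lambda>i\<in>{k}. X i \<omega>)" for \<omega>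
  define c where "c j y = (\<Sum>i\<in>A. \<epsilon> i * (2 * h i j (y i)))
      + (\<Sum>i\<in>R - A. h i j (y i) - expectation (\<lambda>\<eta>. h i j (X i \<eta>)))"
    for j and y :: "'i \<Rightarrow> 'x"
  have c_Y: "c j (Y \<omega>) = partially_symmetrized (I - {k}) (\<lambda>i j \<omega>. h i j (X i \<omega>)) A \<epsilon> j \<omega>" for j \<omega>
    unfolding c_def Y_def partially_symmetrized_def R_def[symmetric]
    using R(2) by (intro arg_cong2[where f = "(+)"] sum.cong) auto
  have h_Xk: "h k j (Xk \<omega> k) = h k j (X k \<omega>)" for j \<omega> by (simp add: Xk_def)
  have "E A \<epsilon> = expectation (\<lambda>\<omega>. max_abs J (\<lambda>j. c j (Y \<omega>)
      + (h k j (Xk \<omega> k) - expectation (\<lambda>\<eta>. h k j (Xk \<eta> k)))))"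
    unfolding E_def partially_symmetrized_remove[OF I k] c_Y h_Xk ..
  also have "\<dots> \<le> (expectation (\<lambda>\<omega>. max_abs J (\<lambda>j. c j (Y \<omega>) + 2 * h k j (Xk \<omega> k)))
      + expectation (\<lambda>\<omega>. max_abs J (\<lambda>j. c j (Y \<omega>) - 2 * h k j (Xk \<omega> k)))) / 2"
  proof (rule symmetrization_indep_var[OF _ J, where c = c and h = "\<lambda>j y. h k j (y k)"])
    show "indep_var (PiM R S) Y (PiM {k} S) Xk"
      unfolding Y_def Xk_def using indep k(1) by (intro indep_var_restrict) (auto simp: R_def)
    show "c j \<in> borel_measurable (PiM R S)" if "j \<in> J" for j
      unfolding c_def using R
      by (intro borel_measurable_add borel_measurable_sum borel_measurable_times
          borel_measurable_diff borel_measurable_const measurable_comp_component h that) auto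
    show "integrable M (\<lambda>\<omega>. c j (Y \<omega>))" if "j \<in> J" for j
      unfolding c_Y partially_symmetrized_def using A
      by (intro Bochner_Integration.integrable_add Bochner_Integration.integrable_sum
          Bochner_Integration.integrable_diff integrable_mult_right integrable_const int that) auto
    show "(\<lambda>y. h k j (y k)) \<in> borel_measurable (PiM {k} S)" if "j \<in> J" for j
      using that k(1) by (intro measurable_comp_component h) simp_all
    show "integrable M (\<lambda>\<omega>. h k j (Xk \<omega> k))" if "j \<in> J" for j
      unfolding h_Xk using k(1) that by (rule int)
  qed
  also have "\<dots> = (E (insert k A) (\<epsilon>(k := 1)) + E (insert k A) (\<epsilon>(k := -1))) / 2"
    unfolding E_def partially_symmetrized_insert[OF finite_subset[OF A I] k(2)] c_Y h_Xk by simp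
  finally show ?thesis .
qed

lemma symmetrization:
  fixes X :: "'i \<Rightarrow> 'a \<Rightarrow> 'x" and h :: "'i \<Rightarrow> 'j \<Rightarrow> 'x \<Rightarrow> real"
  assumes indep: "indep_vars S X I" and I: "finite I" and J: "finite J" "J \<noteq> {}"
    and h: "\<And>i j. i \<in> I \<Longrightarrow> j \<in> J \<Longrightarrow> h i j \<in> borel_measurable (S i)"
    and int: "\<And>i j. i \<in> I \<Longrightarrow> j \<in> J \<Longrightarrow> integrable M (\<lambda>\<omega>. h i j (X i \<omega>))"
  defines "Z \<equiv> \<lambda>i j \<omega>. h i j (X i \<omega>)"
  shows "expectation (\<lambda>\<omega>. max_abs J (\<lambda>j. \<Sum>i\<in>I. Z i j \<omega> - expectation (Z i j)))
    \<le> 2 * expectation (\<lambda>\<omega>. rademacher_average I (\<lambda>\<epsilon>. max_abs J (\<lambda>j. \<Sum>i\<in>I. \<epsilon> i * Z i j \<omega>)))"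
proof -
  define E where "E A \<epsilon> = expectation (\<lambda>\<omega>. max_abs J (\<lambda>j. partially_symmetrized I Z A \<epsilon> j \<omega>))"
    for A \<epsilon>
  have step: "E A \<epsilon> \<le> (E (insert k A) (\<epsilon>(k := 1)) + E (insert k A) (\<epsilon>(k := -1))) / 2"
    if "A \<subseteq> I" "k \<in> I" "k \<notin> A" for A k \<epsilon>
    unfolding E_def Z_def
    by (rule expectation_partially_symmetrized_le_insert[OF indep I J h int that])
  have E_le: "E {} (\<lambda>_. 0) \<le> rademacher_average A (E A)" if "A \<subseteq> I" for A
    using finite_subset[OF that I] that
  proof (induction A rule: finite_induct)
    case empty
    show ?case by (simp add: rademacher_def)
  next
    case (insert k A)
    then have "E {} (\<lambda>_. 0) \<le> rademacher_average A (E A)" by simp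
    also have "\<dots> \<le> rademacher_average A
        (\<lambda>\<epsilon>. (E (insert k A) (\<epsilon>(k := 1)) + E (insert k A) (\<epsilon>(k := -1))) / 2)"
      using insert by (intro integral_mono integrable_rademacher step) auto
    also have "\<dots> = rademacher_average (insert k A) (E (insert k A))"
      using insert.hyps by (rule rademacher_average_insert[symmetric])
    finally show ?case .
  qed
  have "expectation (\<lambda>\<omega>. max_abs J (\<lambda>j. \<Sum>i\<in>I. Z i j \<omega> - expectation (Z i j)))
      \<le> rademacher_average I (\<lambda>\<epsilon>. expectation (\<lambda>\<omega>. max_abs J (\<lambda>j. \<Sum>i\<in>I. \<epsilon> i * (2 * Z i j \<omega>))))"
    using E_le[OF subset_refl] by (simp add: E_def[abs_def] partially_symmetrized_def)
  also have "\<dots> = rademacher_average I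
      (\<lambda>\<epsilon>. expectation (\<lambda>\<omega>. max_abs J (\<lambda>j. 2 * (\<Sum>i\<in>I. \<epsilon> i * Z i j \<omega>))))"
    by (simp add: sum_distrib_left mult_ac)
  also have "\<dots> = 2 * rademacher_average I
      (\<lambda>\<epsilon>. expectation (\<lambda>\<omega>. max_abs J (\<lambda>j. \<Sum>i\<in>I. \<epsilon> i * Z i j \<omega>)))"
    by (simp add: max_abs_cmult[OF J])
  also have "\<dots> = 2 * expectation (\<lambda>\<omega>. rademacher_average I
      (\<lambda>\<epsilon>. max_abs J (\<lambda>j. \<Sum>i\<in>I. \<epsilon> i * Z i j \<omega>)))"
    using int unfolding Z_def by (subst integral_expectation_pmf_swap)
      (auto intro!: finite_set_pmf_rademacher I integrable_max_abs J)
  finally show ?thesis .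
qed

end

subsection \<open>Expected supremum over a finite VC-subgraph class\<close>

lemma times_log_factor_le_tangent:
  assumes "0 \<le> y" "0 < s"
  shows "y * log_factor y \<le> y * (log_factor s - 1) + s"
proof (cases "y = 0")
  case False
  then have y: "y > 0" using assms by simp
  have "ln (s / y) \<le> s / y - 1" using y assms by (intro ln_le_minus_one) auto
  then have "y * ln (s / y) \<le> y * (s / y - 1)" using y by (intro mult_left_mono) auto
  then have "y * ln (1 / y) - y * ln (1 / s) \<le> s - y"
    using y assms by (simp add: ln_div right_diff_distrib)
  then show ?thesis by (simp add: log_factor_def distrib_left)
qed (use assms in simp)

lemma times_log_factor_nonneg:
  assumes "0 \<le> y" "y \<le> 1"
  shows "0 \<le> y * log_factor y"
proof -
  have "0 \<le> ln (1 / y)" using assms by (cases "y = 0") auto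
  then show ?thesis using assms by (simp add: log_factor_def)
qed

lemma le_add_of_square_le:
  fixes b A B :: real
  assumes "0 \<le> A" "0 \<le> B" "b\<^sup>2 \<le> A\<^sup>2 + B * b"
  shows "b \<le> A + B"
proof (rule ccontr)
  assume "\<not> b \<le> A + B"
  then have b: "A + B < b" by simp
  then have "A * A \<le> A * b" "(A + B) * b < b * b"
    using assms(1,2) by (auto intro!: mult_left_mono mult_strict_right_mono)
  then show False using assms(3) by (simp add: power2_eq_square distrib_right)
qed

locale VC_subgraph_sample = prob_space M for M :: "'b measure" +
  fixes Xs :: "'a measure" and X :: "'i \<Rightarrow> 'b \<Rightarrow> 'a" and I :: "'i set"
    and J :: "('a \<Rightarrow> real) set" and V :: real
  assumes indep: "indep_vars (\<lambda>_. Xs) X I" and I: "finite I" "I \<noteq> {}" and J: "finite J" "J \<noteq> {}"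
    and measurable_J: "\<And>f. f \<in> J \<Longrightarrow> f \<in> borel_measurable Xs"
    and abs_J_le_1: "\<And>f y. f \<in> J \<Longrightarrow> y \<in> space Xs \<Longrightarrow> \<bar>f y\<bar> \<le> 1"
    and V: "1 \<le> V" and VC: "VC_subgraph_le (space Xs) J V"
begin

definition deviation :: "(real \<Rightarrow> real) \<Rightarrow> 'b \<Rightarrow> real" where
  "deviation \<phi> \<omega> = max_abs J (\<lambda>f. \<Sum>i\<in>I. \<phi> (f (X i \<omega>)) - expectation (\<lambda>\<eta>. \<phi> (f (X i \<eta>))))"

definition max_mean_square :: "'b \<Rightarrow> real" where
  "max_mean_square \<omega> = max_abs J (\<lambda>f. mean_square I (\<lambda>i. f (X i \<omega>)))"

definition chaining_bound :: "'b \<Rightarrow> real" where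
  "chaining_bound \<omega> = 2.37 * sqrt (real (card I) * V *
    (max_mean_square \<omega> * log_factor (max_mean_square \<omega>)))"

lemma card_I_pos: "0 < real (card I)"
  using I by (simp add: card_gt_0_iff)

lemma X_measurable: "i \<in> I \<Longrightarrow> X i \<in> measurable M Xs"
  using indep by (simp add: indep_vars_def)

lemma measurable_J_X: "f \<in> J \<Longrightarrow> i \<in> I \<Longrightarrow> (\<lambda>\<omega>. f (X i \<omega>)) \<in> borel_measurable M"
  using measurable_compose[OF X_measurable measurable_J] .

lemma abs_J_X_le_1: "f \<in> J \<Longrightarrow> i \<in> I \<Longrightarrow> \<omega> \<in> space M \<Longrightarrow> \<bar>f (X i \<omega>)\<bar> \<le> 1"
  using abs_J_le_1 measurable_space[OF X_measurable] by blast

lemma max_mean_square_bounds: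
  assumes "\<omega> \<in> space M"
  shows "0 \<le> max_mean_square \<omega>" "max_mean_square \<omega> \<le> 1"
proof -
  show "0 \<le> max_mean_square \<omega>" unfolding max_mean_square_def by (rule max_abs_nonneg[OF J])
  show "max_mean_square \<omega> \<le> 1" unfolding max_mean_square_def
    using abs_J_X_le_1 assms by (intro max_abs_le J) (simp add: mean_square_nonneg mean_square_le_1)
qed

lemma borel_measurable_max_mean_square [measurable]: "max_mean_square \<in> borel_measurable M"
  unfolding max_mean_square_def mean_square_def
  by (intro borel_measurable_max_abs J borel_measurable_divide borel_measurable_sum
      borel_measurable_power measurable_J_X borel_measurable_const)

lemma integrable_max_mean_square: "integrable M max_mean_square"
  using max_mean_square_bounds by (intro integrable_const_bound[where B = 1]) auto

lemma chaining_bound_nonneg: "\<omega> \<in> space M \<Longrightarrow> 0 \<le> chaining_bound \<omega>"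
  unfolding chaining_bound_def using V times_log_factor_nonneg max_mean_square_bounds by simp

lemma chaining_bound_square_le:
  assumes \<omega>: "\<omega> \<in> space M" and s: "0 < s"
  shows "(chaining_bound \<omega>)\<^sup>2
    \<le> 2.37\<^sup>2 * (real (card I) * V) * (max_mean_square \<omega> * (log_factor s - 1) + s)"
proof -
  let ?S = "max_mean_square \<omega>"
  have "(chaining_bound \<omega>)\<^sup>2 = 2.37\<^sup>2 * (real (card I) * V) * (?S * log_factor ?S)"
    unfolding chaining_bound_def power_mult_distrib
    using times_log_factor_nonneg[OF max_mean_square_bounds[OF \<omega>]] V by simp
  also have "\<dots> \<le> 2.37\<^sup>2 * (real (card I) * V) * (?S * (log_factor s - 1) + s)"
    using V by (intro mult_left_mono times_log_factor_le_tangent max_mean_square_bounds \<omega> s) auto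
  finally show ?thesis .
qed

lemma borel_measurable_chaining_bound [measurable]: "chaining_bound \<in> borel_measurable M"
  unfolding chaining_bound_def log_factor_def by measurable

lemma integrable_chaining_bound_square: "integrable M (\<lambda>\<omega>. (chaining_bound \<omega>)\<^sup>2)"
proof (rule Bochner_Integration.integrable_bound)
  show "integrable M (\<lambda>\<omega>. 2.37\<^sup>2 * (real (card I) * V) * (max_mean_square \<omega> * (log_factor 1 - 1)
      + 1))"
    using integrable_max_mean_square by simp
  show "AE \<omega> in M. norm ((chaining_bound \<omega>)\<^sup>2)
      \<le> norm (2.37\<^sup>2 * (real (card I) * V) * (max_mean_square \<omega> * (log_factor 1 - 1) + 1))"
    using chaining_bound_square_le[of _ 1]
    by (intro AE_I2) (simp add: order_trans[OF _ abs_ge_self])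
qed measurable

lemma integrable_chaining_bound: "integrable M chaining_bound"
  by (rule square_integrable_imp_integrable[OF _ integrable_chaining_bound_square]) simp

lemma integrable_comp_J_X:
  fixes \<phi> :: "real \<Rightarrow> real" and b :: real
  assumes \<phi>: "\<phi> \<in> borel_measurable borel" and bound: "\<And>a. \<bar>a\<bar> \<le> 1 \<Longrightarrow> \<bar>\<phi> a\<bar> \<le> b"
    and f: "f \<in> J" and i: "i \<in> I"
  shows "integrable M (\<lambda>\<omega>. \<phi> (f (X i \<omega>)))"
  using abs_J_X_le_1[OF f i] measurable_compose[OF measurable_J_X[OF f i] \<phi>]
  by (intro integrable_const_bound[where B = b]) (auto intro!: bound)

lemma expectation_deviation_le:
  assumes \<phi>: "\<phi> \<in> borel_measurable borel" "\<phi> 0 = 0" and l: "0 < l"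
    and lip: "\<And>a b. \<bar>a\<bar> \<le> 1 \<Longrightarrow> \<bar>b\<bar> \<le> 1 \<Longrightarrow> \<bar>\<phi> a - \<phi> b\<bar> \<le> l * \<bar>a - b\<bar>"
  shows "expectation (deviation \<phi>) \<le> 2 * l * expectation chaining_bound"
proof -
  have "\<bar>\<phi> a\<bar> \<le> l" if "\<bar>a\<bar> \<le> 1" for a
  proof -
    have "\<bar>\<phi> a\<bar> \<le> l * \<bar>a\<bar>" using lip[OF that, of 0] \<phi>(2) by simp
    also have "\<dots> \<le> l * 1" using that l by (intro mult_left_mono) auto
    finally show ?thesis by simp
  qed
  then have int: "integrable M (\<lambda>\<omega>. \<phi> (f (X i \<omega>)))" if "f \<in> J" "i \<in> I" for f i
    using that by (intro integrable_comp_J_X[OF \<phi>(1)])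
  define R where "R \<omega> = rademacher_average I
    (\<lambda>\<epsilon>. max_abs J (\<lambda>f. \<Sum>i\<in>I. \<epsilon> i * \<phi> (f (X i \<omega>))))" for \<omega>
  have "expectation (deviation \<phi>) \<le> 2 * expectation R"
    unfolding deviation_def R_def
    using int measurable_compose[OF measurable_J \<phi>(1)]
    by (intro symmetrization[OF indep I(1) J, where h = "\<lambda>i f y. \<phi> (f y)"]) auto
  also have "expectation R \<le> expectation (\<lambda>\<omega>. l * chaining_bound \<omega>)"
  proof (rule integral_mono)
    show "integrable M R"
      unfolding R_def using int
      by (intro integrable_expectation_pmf finite_set_pmf_rademacher I integrable_max_abs J) auto
    show "integrable M (\<lambda>\<omega>. l * chaining_bound \<omega>)" using integrable_chaining_bound by simp
    show "R \<omega> \<le> l * chaining_bound \<omega>" if "\<omega> \<in> space M" for \<omega>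
      unfolding R_def chaining_bound_def max_mean_square_def
      using that measurable_space[OF X_measurable] abs_J_X_le_1
      by (intro rademacher_average_VC_subgraph_le[OF I _ J VC V _ \<phi>(2) l lip]) auto
  qed
  finally show ?thesis by simp
qed

lemma expectation_max_mean_square_le:
  assumes s: "\<And>f. f \<in> J \<Longrightarrow> (\<Sum>i\<in>I. expectation (\<lambda>\<omega>. (f (X i \<omega>))\<^sup>2)) \<le> real (card I) * s"
  shows "expectation max_mean_square \<le> s + 4 * expectation chaining_bound / real (card I)"
proof -
  let ?n = "real (card I)"
  have lip: "\<bar>a\<^sup>2 - b\<^sup>2\<bar> \<le> 2 * \<bar>a - b\<bar>" if "\<bar>a\<bar> \<le> 1" "\<bar>b\<bar> \<le> 1" for a b :: real
  proof -
    have "\<bar>a\<^sup>2 - b\<^sup>2\<bar> = \<bar>a + b\<bar> * \<bar>a - b\<bar>"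
      by (simp add: abs_mult[symmetric] power2_eq_square algebra_simps)
    also have "\<dots> \<le> 2 * \<bar>a - b\<bar>" using that by (intro mult_right_mono) auto
    finally show ?thesis .
  qed
  have "integrable M (\<lambda>\<omega>. (f (X i \<omega>))\<^sup>2)" if "f \<in> J" "i \<in> I" for f i
    using that by (intro integrable_comp_J_X[where b = 1]) (auto simp: abs_square_le_1)
  then have dev_int: "integrable M (deviation power2)"
    unfolding deviation_def by (intro integrable_max_abs J) auto
  have "max_mean_square \<omega> \<le> s + deviation power2 \<omega> / ?n" if "\<omega> \<in> space M" for \<omega>
    unfolding max_mean_square_def
  proof (rule max_abs_le[OF J])
    fix f assume f: "f \<in> J"
    have "(\<Sum>i\<in>I. (f (X i \<omega>))\<^sup>2 - expectation (\<lambda>\<eta>. (f (X i \<eta>))\<^sup>2)) \<le> deviation power2 \<omega>"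
      unfolding deviation_def using J(1) f by (rule order_trans[OF abs_ge_self abs_le_max_abs])
    then have "?n * mean_square I (\<lambda>i. f (X i \<omega>)) \<le> ?n * s + deviation power2 \<omega>"
      using s[OF f] by (simp add: sum_subtractf card_times_mean_square)
    then show "\<bar>mean_square I (\<lambda>i. f (X i \<omega>))\<bar> \<le> s + deviation power2 \<omega> / ?n"
      using card_I_pos by (simp add: mean_square_nonneg field_simps)
  qed
  then have "expectation max_mean_square \<le> expectation (\<lambda>\<omega>. s + deviation power2 \<omega> / ?n)"
    using dev_int by (intro integral_mono integrable_max_mean_square) auto
  also have "\<dots> = s + expectation (deviation power2) / ?n" using dev_int by (simp add: prob_space)
  also have "\<dots> \<le> s + (2 * 2 * expectation chaining_bound) / ?n"
    using expectation_deviation_le[of power2 2] lip card_I_pos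
    by (intro add_left_mono divide_right_mono) auto
  finally show ?thesis by simp
qed

lemma expectation_chaining_bound_le:
  assumes s: "0 < s" "s \<le> 1"
    and var: "\<And>f. f \<in> J \<Longrightarrow> (\<Sum>i\<in>I. expectation (\<lambda>\<omega>. (f (X i \<omega>))\<^sup>2)) \<le> real (card I) * s"
  shows "expectation chaining_bound
      \<le> 2.37 * sqrt (real (card I) * V * s * log_factor s) + 45 * V * log_factor s"
proof -
  let ?n = "real (card I)" and ?L = "log_factor s" and ?C = "2.37\<^sup>2 :: real"
  define b where "b = expectation chaining_bound"
  have b_nonneg: "0 \<le> b"
    unfolding b_def using chaining_bound_nonneg by (intro Bochner_Integration.integral_nonneg)
  have "0 \<le> ln (1 / s)" using s by simp
  then have log_factor_ge_1: "1 \<le> ?L" by (simp add: log_factor_def)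
  have nonneg: "0 \<le> ?n * V * s * ?L" using V s(1) log_factor_ge_1 by (intro mult_nonneg_nonneg) auto
  have "b\<^sup>2 \<le> expectation (\<lambda>\<omega>. (chaining_bound \<omega>)\<^sup>2)"
    using variance_eq[OF integrable_chaining_bound integrable_chaining_bound_square]
      variance_positive[of chaining_bound] by (simp add: b_def)
  also have "\<dots> \<le> expectation (\<lambda>\<omega>. ?C * (?n * V) * (max_mean_square \<omega> * (?L - 1) + s))"
    using integrable_max_mean_square s(1)
    by (intro integral_mono integrable_chaining_bound_square chaining_bound_square_le) auto
  also have "\<dots> = ?C * (?n * V) * (expectation max_mean_square * (?L - 1) + s)"
    using integrable_max_mean_square by (simp add: prob_space)
  also have "\<dots> \<le> ?C * (?n * V) * ((s + 4 * b / ?n) * (?L - 1) + s)"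
    using expectation_max_mean_square_le[OF var] V log_factor_ge_1
    by (intro mult_left_mono add_right_mono mult_right_mono) (auto simp: b_def)
  also have "\<dots> = ?C * (?n * V * s * ?L) + ?C * 4 * V * (?L - 1) * b"
    using card_I_pos by (simp add: field_simps)
  also have "\<dots> \<le> ?C * (?n * V * s * ?L) + 45 * V * ?L * b"
  proof -
    have "?C * 4 * V * (?L - 1) * b \<le> 45 * V * ?L * b"
      using V log_factor_ge_1 b_nonneg
      by (intro mult_right_mono mult_mono) (auto simp: power2_eq_square)
    then show ?thesis by simp
  qed
  also have "?C * (?n * V * s * ?L) = (2.37 * sqrt (?n * V * s * ?L))\<^sup>2"
    unfolding power_mult_distrib real_sqrt_pow2[OF nonneg] ..
  finally have "b\<^sup>2 \<le> (2.37 * sqrt (?n * V * s * ?L))\<^sup>2 + 45 * V * ?L * b" .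
  then show ?thesis
    unfolding b_def[symmetric]
    by (rule le_add_of_square_le[rotated 2]) (use nonneg V log_factor_ge_1 in simp_all)
qed

lemma expectation_max_abs_sum_le:
  assumes s: "0 < s" "s \<le> 1"
    and var: "\<And>f. f \<in> J \<Longrightarrow> (\<Sum>i\<in>I. expectation (\<lambda>\<omega>. (f (X i \<omega>))\<^sup>2)) \<le> real (card I) * s"
  shows "expectation (\<lambda>\<omega>. max_abs J (\<lambda>f. \<Sum>i\<in>I. f (X i \<omega>) - expectation (\<lambda>\<eta>. f (X i \<eta>))))
    \<le> 4.74 * sqrt (real (card I) * V * s * log_factor s) + 90 * V * log_factor s"
  using expectation_deviation_le[of "\<lambda>a. a" 1] expectation_chaining_bound_le[OF s var]
  by (simp add: deviation_def[abs_def])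

end

subsection \<open>Countable classes\<close>

lemma SUP_ennreal_abs_eq_SUP_max_abs:
  fixes z :: "nat \<Rightarrow> real"
  shows "(SUP k. ennreal \<bar>z k\<bar>) = (SUP K. ennreal (max_abs {..K} z))"
proof (rule antisym)
  show "(SUP k. ennreal \<bar>z k\<bar>) \<le> (SUP K. ennreal (max_abs {..K} z))"
    by (intro SUP_mono bexI[of _ "_::nat"] ennreal_leI abs_le_max_abs) auto
  show "(SUP K. ennreal (max_abs {..K} z)) \<le> (SUP k. ennreal \<bar>z k\<bar>)"
  proof (rule SUP_least)
    fix K :: nat
    obtain k where "max_abs {..K} z = \<bar>z k\<bar>" using max_abs_attained[of "{..K}" z] by auto
    then show "ennreal (max_abs {..K} z) \<le> (SUP k. ennreal \<bar>z k\<bar>)"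
      by (simp only:) (rule SUP_upper[OF UNIV_I])
  qed
qed

lemma nn_integral_SUP_abs_countable_le:
  fixes z :: "'f \<Rightarrow> 'a \<Rightarrow> real"
  assumes F: "countable F" "F \<noteq> {}" and z: "\<And>f. f \<in> F \<Longrightarrow> integrable M (z f)"
    and bound: "\<And>J. finite J \<Longrightarrow> J \<noteq> {} \<Longrightarrow> J \<subseteq> F \<Longrightarrow> (\<integral>x. max_abs J (\<lambda>f. z f x) \<partial>M) \<le> B"
  shows "(\<integral>\<^sup>+ x. (SUP f\<in>F. ennreal \<bar>z f x\<bar>) \<partial>M) \<le> ennreal B"
proof -
  define e where "e = from_nat_into F"
  have F_eq: "F = range e" unfolding e_def using F by (simp add: range_from_nat_into)
  define m where "m K x = max_abs {..K} (\<lambda>k. z (e k) x)" for K :: nat and x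
  have m_eq: "m K x = max_abs (e ` {..K}) (\<lambda>f. z f x)" for K x
    by (simp add: m_def max_abs_def image_image)
  have m_nonneg: "0 \<le> m K x" for K x unfolding m_def by (intro max_abs_nonneg) auto
  have m_int: "integrable M (m K)" for K
    unfolding m_def using z by (intro integrable_max_abs) (auto simp: F_eq)
  have "(\<integral>\<^sup>+ x. (SUP f\<in>F. ennreal \<bar>z f x\<bar>) \<partial>M) = (\<integral>\<^sup>+ x. (SUP K. ennreal (m K x)) \<partial>M)"
    unfolding F_eq image_image m_def by (simp add: SUP_ennreal_abs_eq_SUP_max_abs)
  also have "\<dots> = (SUP K. \<integral>\<^sup>+ x. ennreal (m K x) \<partial>M)"
  proof (rule nn_integral_monotone_convergence_SUP)
    show "incseq (\<lambda>K x. ennreal (m K x))"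
      unfolding m_def by (intro incseq_SucI le_funI ennreal_leI max_abs_le abs_le_max_abs) auto
  qed (use m_int in measurable)
  also have "\<dots> = (SUP K. ennreal (\<integral>x. m K x \<partial>M))"
    using m_nonneg by (intro SUP_cong refl nn_integral_eq_integral m_int) simp
  also have "\<dots> \<le> ennreal B"
    unfolding m_eq using F_eq by (intro SUP_least ennreal_leI bound) auto
  finally show ?thesis .
qed

theorem theorem2:
  fixes M :: "'b measure" and Xs :: "'a measure"
    and X :: "nat \<Rightarrow> 'b \<Rightarrow> 'a" and n :: nat
    and F :: "('a \<Rightarrow> real) set" and V \<sigma> :: real
  assumes "prob_space M"
    and "prob_space.indep_vars M (\<lambda>_. Xs) X {1..n}"
    and "countable F"
    and "\<And>f. f \<in> F \<Longrightarrow> f \<in> borel_measurable Xs"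
    and "\<And>f x. f \<in> F \<Longrightarrow> x \<in> space Xs \<Longrightarrow> -1 \<le> f x \<and> f x \<le> 1"
    and "V \<ge> 1"
    and "VC_subgraph_le (space Xs) F V"
    and "0 < \<sigma>" and "\<sigma> \<le> 1"
    and "\<And>f. f \<in> F \<Longrightarrow>
           (1 / real n) * (\<Sum>i\<in>{1..n}. prob_space.expectation M (\<lambda>\<omega>. (f (X i \<omega>))\<^sup>2)) \<le> \<sigma>\<^sup>2"
  shows "(\<integral>\<^sup>+ \<omega>. (\<Squnion>f\<in>F. ennreal \<bar>\<Sum>i\<in>{1..n}. f (X i \<omega>) - prob_space.expectation M (\<lambda>\<eta>. f (X i \<eta>))\<bar>) \<partial>M)
         \<le> ennreal (4.74 * sqrt (real n * V * \<sigma>\<^sup>2 * (9.11 + ln (1 / \<sigma>\<^sup>2)))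
                    + 90 * V * (9.11 + ln (1 / \<sigma>\<^sup>2)))"
proof (cases "n = 0 \<or> F = {}")
  case True
  then have "(SUP f\<in>F. ennreal \<bar>\<Sum>i\<in>{1..n}.
      f (X i \<omega>) - prob_space.expectation M (\<lambda>\<eta>. f (X i \<eta>))\<bar>) = 0" for \<omega>
    by (auto simp: bot_ennreal[symmetric] SUP_constant)
  then show ?thesis by simp
next
  case False
  have sample: "VC_subgraph_sample M Xs X {1..n} J V" if "finite J" "J \<noteq> {}" "J \<subseteq> F" for J
    using that assms(1-7) False VC_subgraph_le_subset
    by (auto simp: VC_subgraph_sample_def VC_subgraph_sample_axioms_def abs_le_iff)
  show ?thesis
  proof (rule nn_integral_SUP_abs_countable_le[OF assms(3)])
    fix J assume J_F: "finite J" "J \<noteq> {}" "J \<subseteq> F"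
    interpret VC_subgraph_sample M Xs X "{1..n}" J V using J_F by (rule sample)
    show "expectation (\<lambda>\<omega>. max_abs J (\<lambda>f. \<Sum>i\<in>{1..n}. f (X i \<omega>) - expectation (\<lambda>\<eta>. f (X i \<eta>))))
        \<le> 4.74 * sqrt (real n * V * \<sigma>\<^sup>2 * (9.11 + ln (1 / \<sigma>\<^sup>2))) + 90 * V * (9.11 + ln (1 / \<sigma>\<^sup>2))"
      using expectation_max_abs_sum_le[of "\<sigma>\<^sup>2"] assms(8-10) J_F(3) False
      by (auto simp: log_factor_def power_le_one field_simps)
  next
    fix f assume "f \<in> F"
    then interpret VC_subgraph_sample M Xs X "{1..n}" "{f}" V by (intro sample) auto
    show "integrable M (\<lambda>\<omega>. \<Sum>i\<in>{1..n}. f (X i \<omega>) - expectation (\<lambda>\<eta>. f (X i \<eta>)))"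
      using integrable_comp_J_X[of "\<lambda>a. a" 1] by auto
  qed (use False in simp)
qed

end
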